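(* Let $g(t)=\sum_{k=1}^N\frac{a_k}{t-iw_k}$ with $a_k,w_k\in\mathbb{C}$, $a_k\neq0$, $\Re w_k\neq 0$, and $\Re w_k\neq\Re w_l$ for $k\neq l$. Then $$\Big\{(\alpha,\beta):\ \alpha,\beta>0,\ \alpha\beta\le \tfrac1N\Big\}\subset\mathcal{F}(g).$$
   Context: For $\alpha,\beta>0$, $\mathcal{G}(g;\alpha,\beta)=\{e^{2\pi i\beta n t}g(t-\alpha m)\}_{m,n\in\mathbb{Z}}$; it is a frame in $L^2(\mathbb{R})$ if there are $0<A\le B<\infty$ with $A\|f\|^2\le\sum_{m,n}|\langle f, e^{2\pi i\beta n\cdot}g(\cdot-\alpha m)\rangle|^2\le B\|f\|^2$ for all $f\in L^2(\mathbb{R})$. The frame set $\mathcal{F}(g)$ is the set of all $(\alpha,\beta)$ with $\alpha,\beta>0$ for which $\mathcal{G}(g;\alpha,\beta)$ is a frame. *)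

theory Defs
  imports "HOL-Analysis.Analysis"
begin

definition L2 :: "(real \<Rightarrow> complex) set" where
  "L2 = {f. f \<in> borel_measurable lborel \<and> integrable lborel (\<lambda>t. (cmod (f t))\<^sup>2)}"

definition L2_inner :: "(real \<Rightarrow> complex) \<Rightarrow> (real \<Rightarrow> complex) \<Rightarrow> complex" where
  "L2_inner f h = integral\<^sup>L lborel (\<lambda>t. f t * cnj (h t))"

definition L2_normsq :: "(real \<Rightarrow> complex) \<Rightarrow> real" where
  "L2_normsq f = integral\<^sup>L lborel (\<lambda>t. (cmod (f t))\<^sup>2)"

definition gabor_atom :: "(real \<Rightarrow> complex) \<Rightarrow> real \<Rightarrow> real \<Rightarrow> int \<Rightarrow> int \<Rightarrow> real \<Rightarrow> complex" where
  "gabor_atom g \<alpha> \<beta> m n t =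
     exp (2 * complex_of_real pi * \<i> * complex_of_real (\<beta> * real_of_int n * t)) * g (t - \<alpha> * real_of_int m)"

definition gabor_frame :: "(real \<Rightarrow> complex) \<Rightarrow> real \<Rightarrow> real \<Rightarrow> bool" where
  "gabor_frame g \<alpha> \<beta> \<longleftrightarrow>
     (\<exists>A B. 0 < A \<and> A \<le> B \<and>
        (\<forall>f\<in>L2. \<exists>s. ((\<lambda>(m, n). (cmod (L2_inner f (gabor_atom g \<alpha> \<beta> m n)))\<^sup>2) has_sum s) UNIV
                    \<and> A * L2_normsq f \<le> s \<and> s \<le> B * L2_normsq f))"

definition frame_set :: "(real \<Rightarrow> complex) \<Rightarrow> (real \<times> real) set" where
  "frame_set g = {(\<alpha>, \<beta>). \<alpha> > 0 \<and> \<beta> > 0 \<and> gabor_frame g \<alpha> \<beta>}"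

end

theory Submission
  imports Defs
begin

text \<open>
  Parseval in the modulation index turns the frame inequality into a fibrewise one: for every
  finitely supported sequence c, the samples v m = (\<Sum>j. c j * g (x + j/\<beta> - \<alpha> m)) must satisfy
  A * (\<Sum>j. |c j|^2) \<le> (\<Sum>m. |v m|^2) \<le> B * (\<Sum>j. |c j|^2), uniformly in x. Each simple fraction
  1/(s + \<alpha> m) is the m-th Fourier coefficient on [0, 1/\<alpha>] of a multiple of exp (2 \<pi> i s t), so
  (\<Sum>m. |v m|^2) is the squared L2 norm on [0, 1/\<alpha>] of
  (\<Sum>k. a k * exp (-2 \<pi> w k t) * D k t), where every D k is a trigonometric polynomial of period \<beta>
  whose coefficients are comparable to the c j. Since 1/\<alpha> \<ge> N \<beta>, the points
  t, t + \<beta>, ..., t + (N - 1) \<beta> all lie in the interval, and the values there form a Vandermonde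
  system in the nodes exp (-2 \<pi> \<beta> w k). These are distinct because the real parts of the w k are,
  so a single D k can be recovered boundedly, which is the lower bound.
\<close>

section \<open>Parseval's identity on an interval\<close>

text \<open>Two unrelated periods meet: the samples in m are Fourier coefficients on
  [0, 1/\<alpha>], while the row sums D k have period \<beta>, and 1/\<alpha> need not be a multiple
  of \<beta>. This shapes the two bounds differently. The upper bound enlarges [0, 1/\<alpha>] to a
  whole number of \<beta>-periods; the lower bound keeps N of them and discards the rest. Uniformity
  in x and in the row index j comes from the fact that s = i w - (x + j/\<beta>) has imaginary part
  Re w whatever x and j are, and the size of the normalising factor of 1/(s + \<alpha> m) is
  controlled by Im s. The remaining obstacle is the passage from finitely supported c to all of L2.
  A bounded f with compact support has a finite periodization, and general f are reached by
  truncation. The upper inequality survives the limit by Fatou; the lower one does not, since Fatou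
  points the wrong way. It is recovered by applying the upper inequality to the remainder of the
  truncation, at the price of halving the lower constant.\<close>

definition fourier_char :: "real \<Rightarrow> int \<Rightarrow> real \<Rightarrow> complex" where
  "fourier_char L n t = cis (2 * pi * real_of_int n * t / L)"

abbreviation lborel_upto :: "real \<Rightarrow> real measure" where
  "lborel_upto L \<equiv> restrict_space lborel {0..L}"

lemma finite_measure_lborel_upto: "finite_measure (lborel_upto L)"
  by (rule finite_measureI) (simp add: emeasure_restrict_space emeasure_lborel_Icc_eq)

lemma space_lborel_upto [simp]: "space (lborel_upto L) = {0..L}"
  by (simp add: space_restrict_space)

lemma borel_measurable_lborel_upto [measurable (raw)]:
  "f \<in> borel_measurable borel \<Longrightarrow> f \<in> borel_measurable (lborel_upto L)"
  by (simp add: measurable_restrict_space1)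

lemma integrable_lborel_upto:
  fixes f :: "real \<Rightarrow> 'b::{banach, second_countable_topology}"
  assumes "f \<in> borel_measurable borel" "\<And>t. t \<in> {0..L} \<Longrightarrow> norm (f t) \<le> B"
  shows "integrable (lborel_upto L) f"
  by (rule finite_measure.integrable_const_bound[OF finite_measure_lborel_upto, where B = B])
     (use assms in \<open>auto intro!: borel_measurable_lborel_upto AE_I2\<close>)

lemma integrable_lborel_upto_continuous:
  fixes f :: "real \<Rightarrow> 'b::{banach, second_countable_topology}"
  assumes "continuous_on UNIV f"
  shows "integrable (lborel_upto L) f"
proof -
  have "compact (f ` {0..L})"
    by (intro compact_continuous_image continuous_on_subset[OF assms]) auto
  then obtain B where "\<And>t. t \<in> {0..L} \<Longrightarrow> norm (f t) \<le> B"
    using compact_imp_bounded bounded_iff by (metis imageI)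
  thus ?thesis
    by (intro integrable_lborel_upto[where B = B] borel_measurable_continuous_onI assms)
qed

section \<open>Exponentials and characters over [0, L]\<close>

lemma integral_exp_lborel_upto:
  fixes z :: complex
  assumes "z \<noteq> 0" "L \<ge> 0"
  shows "(\<integral>t. exp (z * of_real t) \<partial>lborel_upto L) = (exp (z * of_real L) - 1) / z"
proof -
  have "(\<integral>t. indicator {0..L} t *\<^sub>R exp (z * of_real t) \<partial>lborel) =
        exp (z * of_real L) / z - exp (z * of_real 0) / z"
  proof (rule integral_FTC_Icc[OF assms(2)])
    fix t :: real
    have "((\<lambda>w. exp (z * w) / z) has_field_derivative exp (z * of_real t)) (at (of_real t))"
      using assms by (auto intro!: derivative_eq_intros)
    thus "((\<lambda>t. exp (z * of_real t) / z) has_vector_derivative exp (z * of_real t)) (at t within {0..L})"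
      using has_vector_derivative_real_field[of "\<lambda>w. exp (z * w) / z"]
            has_vector_derivative_at_within by (simp add: field_vector_diff_chain_at)
  qed (intro continuous_intros)
  thus ?thesis by (simp add: integral_restrict_space diff_divide_distrib)
qed

lemma measure_lborel_upto: "L \<ge> 0 \<Longrightarrow> measure (lborel_upto L) {0..L} = L"
  by (simp add: measure_restrict_space)

lemma integral_const_lborel_upto:
  "L \<ge> 0 \<Longrightarrow> (\<integral>t. c \<partial>lborel_upto L) = L *\<^sub>R (c :: 'b::{banach, second_countable_topology})"
  by (simp add: measure_lborel_upto)

lemma fourier_char_eq_exp:
  "fourier_char L n t = exp (2 * of_real pi * \<i> * of_int n / of_real L * of_real t)"
  unfolding fourier_char_def cis_conv_exp by (simp add: field_simps)

lemma continuous_on_fourier_char [continuous_intros]: "continuous_on A (fourier_char L n)"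
proof -
  have "continuous_on A (\<lambda>t. exp (z * complex_of_real t))" for z
    by (intro continuous_intros)
  thus ?thesis unfolding fourier_char_eq_exp[abs_def] .
qed

lemma fourier_char_measurable [measurable]: "fourier_char L n \<in> borel_measurable borel"
  by (intro borel_measurable_continuous_onI continuous_intros)

lemma norm_fourier_char [simp]: "cmod (fourier_char L n t) = 1"
  by (simp add: fourier_char_def)

lemma borel_measurable_cnj [measurable (raw)]:
  "f \<in> borel_measurable M \<Longrightarrow> (\<lambda>x. cnj (f x)) \<in> borel_measurable M"
  by (rule borel_measurable_continuous_on) (auto intro: continuous_intros)

lemma fourier_char_mult: "fourier_char L n t * fourier_char L m t = fourier_char L (n + m) t"
  by (simp add: fourier_char_def cis_mult add_divide_distrib algebra_simps)

lemma cnj_fourier_char: "cnj (fourier_char L n t) = fourier_char L (- n) t"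
  by (simp add: fourier_char_def cis_cnj)

lemma fourier_char_0 [simp]: "fourier_char L 0 t = 1"
  by (simp add: fourier_char_def)

lemma fourier_char_period:
  assumes "L \<noteq> 0"
  shows "fourier_char L n (t + of_int k * L) = fourier_char L n t"
proof -
  have "fourier_char L n (t + of_int k * L) =
        fourier_char L n t * cis (2 * pi * real_of_int (n * k))"
    using assms by (simp add: fourier_char_def cis_mult field_simps)
  thus ?thesis by (simp only: cis_multiple_2pi Ints_of_int mult_1_right)
qed

lemma integral_fourier_char:
  assumes "L > 0"
  shows "(\<integral>t. fourier_char L n t \<partial>lborel_upto L) = (if n = 0 then of_real L else 0)"
proof (cases "n = 0")
  case True
  thus ?thesis using assms by (simp add: integral_const_lborel_upto scaleR_conv_of_real measure_lborel_upto)
next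
  case False
  define z where "z = 2 * of_real pi * \<i> * of_int n / of_real L"
  have z: "z \<noteq> 0" using False assms by (simp add: z_def)
  have "z * of_real L = 2 * of_real pi * \<i> * of_int n"
    using assms by (simp add: z_def)
  also have "exp \<dots> = 1"
    by (metis cis_multiple_2pi Ints_of_int cis_conv_exp mult.assoc mult.commute of_real_mult of_real_numeral of_real_of_int_eq)
  finally have "exp (z * of_real L) = 1" .
  thus ?thesis
    unfolding fourier_char_eq_exp z_def[symmetric]
    using integral_exp_lborel_upto[OF z, of L] assms False by simp
qed

lemma integral_fourier_char_cnj:
  assumes "L > 0"
  shows "(\<integral>t. fourier_char L n t * cnj (fourier_char L m t) \<partial>lborel_upto L) =
         (if n = m then of_real L else 0)"
  unfolding cnj_fourier_char fourier_char_mult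
  using integral_fourier_char[OF assms, of "n + - m"] by simp

section \<open>Trigonometric polynomials and their density, uniform and in mean square\<close>

definition trig_poly :: "real \<Rightarrow> (real \<Rightarrow> complex) set" where
  "trig_poly L = {p. \<exists>F c. finite F \<and> p = (\<lambda>t. \<Sum>n\<in>F. c n * fourier_char L n t)}"

lemma trig_polyE:
  assumes "p \<in> trig_poly L"
  obtains F c where "finite F" "p = (\<lambda>t. \<Sum>n\<in>F. c n * fourier_char L n t)"
  using assms unfolding trig_poly_def by auto

lemma trig_poly_char: "(\<lambda>t. c * fourier_char L n t) \<in> trig_poly L"
  unfolding trig_poly_def by (rule CollectI, rule exI[of _ "{n}"]) (auto intro!: exI[of _ "\<lambda>_. c"])

lemma trig_poly_const: "(\<lambda>t. c) \<in> trig_poly L"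
  using trig_poly_char[of c L 0] by simp

lemma trig_poly_add:
  assumes "p \<in> trig_poly L" "q \<in> trig_poly L"
  shows "(\<lambda>t. p t + q t) \<in> trig_poly L"
proof -
  obtain F c where F: "finite F" "p = (\<lambda>t. \<Sum>n\<in>F. c n * fourier_char L n t)"
    using assms by (elim trig_polyE)
  obtain G d where G: "finite G" "q = (\<lambda>t. \<Sum>n\<in>G. d n * fourier_char L n t)"
    using assms by (elim trig_polyE)
  have "p t + q t = (\<Sum>n\<in>F \<union> G. ((if n \<in> F then c n else 0) + (if n \<in> G then d n else 0)) * fourier_char L n t)" for t
    unfolding F G distrib_right sum.distrib
    using F(1) G(1) by (intro arg_cong2[where f = "(+)"] sum.mono_neutral_cong_left) auto
  thus ?thesis using F(1) G(1) unfolding trig_poly_def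
    by (intro CollectI exI[of _ "F \<union> G"] exI[of _ "\<lambda>n. (if n \<in> F then c n else 0) + (if n \<in> G then d n else 0)"]) auto
qed

lemma trig_poly_sum:
  "(\<And>i. i \<in> I \<Longrightarrow> p i \<in> trig_poly L) \<Longrightarrow> (\<lambda>t. \<Sum>i\<in>I. p i t) \<in> trig_poly L"
  by (induction I rule: infinite_finite_induct) (auto intro: trig_poly_add trig_poly_const)

lemma trig_poly_mult:
  assumes "p \<in> trig_poly L" "q \<in> trig_poly L"
  shows "(\<lambda>t. p t * q t) \<in> trig_poly L"
proof -
  obtain F c where F: "finite F" "p = (\<lambda>t. \<Sum>n\<in>F. c n * fourier_char L n t)"
    using assms by (elim trig_polyE)
  obtain G d where G: "finite G" "q = (\<lambda>t. \<Sum>n\<in>G. d n * fourier_char L n t)"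
    using assms by (elim trig_polyE)
  have "p t * q t = (\<Sum>n\<in>F. \<Sum>m\<in>G. (c n * d m) * fourier_char L (n + m) t)" for t
    unfolding F G sum_product fourier_char_mult[symmetric] by (simp add: mult_ac)
  thus ?thesis by (simp add: trig_poly_sum trig_poly_char)
qed

lemma trig_poly_bounded:
  assumes "p \<in> trig_poly L"
  obtains B where "\<And>t. cmod (p t) \<le> B"
proof -
  obtain F c where F: "finite F" "p = (\<lambda>t. \<Sum>n\<in>F. c n * fourier_char L n t)"
    using assms by (elim trig_polyE)
  have "cmod (p t) \<le> (\<Sum>n\<in>F. cmod (c n))" for t
    unfolding F by (rule order_trans[OF norm_sum]) (simp add: norm_mult)
  thus thesis by (rule that)
qed

lemma trig_poly_continuous: "p \<in> trig_poly L \<Longrightarrow> continuous_on A p"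
  by (elim trig_polyE) (auto intro!: continuous_intros)

text \<open>Characters of period L cannot separate 0 from L, so Stone-Weierstrass is applied on the
  unit circle instead of the interval. Functions on the circle whose pullback along
  \<open>\<theta>\<close> is a trigonometric polynomial form an algebra; it contains
  \<open>Re\<close> and \<open>Im\<close>, which separate points.\<close>

lemma trig_poly_dense_real:
  fixes u :: "real \<Rightarrow> real"
  assumes L: "L > 0" and cont: "continuous_on {0..L} u" and per: "u 0 = u L" and e: "e > 0"
  shows "\<exists>p\<in>trig_poly L. \<forall>t\<in>{0..L}. cmod (of_real (u t) - p t) < e"
proof -
  define \<theta> where "\<theta> = fourier_char L 1"
  define P where "P f \<longleftrightarrow> continuous_on (sphere 0 1) f \<and> (\<lambda>t. of_real (f (\<theta> t))) \<in> trig_poly L"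
    for f :: "complex \<Rightarrow> real"
  \<comment> \<open>\<open>K\<close> is \<open>u\<close> transported to the circle. The choice of
    preimage is ambiguous only at the point hit by both 0 and L, where \<open>u 0 = u L\<close>
    makes it harmless.\<close>
  define K where "K z = u (SOME t. t \<in> {0..L} \<and> \<theta> t = z)" for z
  have inj: "s = t \<or> {s, t} = {0, L}" if "s \<in> {0..L}" "t \<in> {0..L}" "\<theta> s = \<theta> t" for s t
  proof -
    have "cis (2 * pi * s / L) = cis (2 * pi * t / L)" using that by (simp add: \<theta>_def fourier_char_def)
    then obtain n :: int where "2 * pi * s / L = 2 * pi * t / L + 2 * pi * of_int n"
      using sin_cos_eq_iff[of "2 * pi * s / L" "2 * pi * t / L"] unfolding cis.ctr complex.inject by blast
    hence "2 * pi * (s / L) = 2 * pi * (t / L + of_int n)" by (simp add: algebra_simps)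
    hence "s / L = t / L + of_int n" by (subst (asm) mult_cancel_left) simp
    hence *: "s = t + of_int n * L" using L by (simp add: field_simps)
    hence "\<bar>of_int n * L\<bar> \<le> L" using that by auto
    hence "\<bar>n\<bar> \<le> 1" using L by (simp add: abs_mult)
    hence "n = 0 \<or> n = 1 \<or> n = -1" by linarith
    thus ?thesis using * that by auto
  qed
  have K: "K (\<theta> t) = u t" if "t \<in> {0..L}" for t
  proof -
    have "(SOME s. s \<in> {0..L} \<and> \<theta> s = \<theta> t) \<in> {0..L} \<and> \<theta> (SOME s. s \<in> {0..L} \<and> \<theta> s = \<theta> t) = \<theta> t"
      by (rule someI[of _ t]) (use that in auto)
    thus ?thesis using inj[of "SOME s. s \<in> {0..L} \<and> \<theta> s = \<theta> t" t] that per unfolding K_def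
      by (auto simp: doubleton_eq_iff)
  qed
  have sph: "sphere 0 1 = \<theta> ` {0..L}"
  proof (intro equalityI subsetI)
    fix z :: complex assume z: "z \<in> sphere 0 1"
    obtain x where x: "0 \<le> x" "x < 2 * pi" "z = cis x"
      using z Arg2pi[of z] by (auto simp: cis_conv_exp is_Arg_def)
    have "\<theta> (x * L / (2 * pi)) = z" using L x by (simp add: \<theta>_def fourier_char_def)
    moreover have "x * L / (2 * pi) \<in> {0..L}" using x L by (auto simp: field_simps)
    ultimately show "z \<in> \<theta> ` {0..L}" by blast
  qed (auto simp: \<theta>_def)
  \<comment> \<open>The graph of K is a continuous image of [0, L], so no explicit inverse of the
    parametrisation of the circle is needed.\<close>
  have contK: "continuous_on (sphere 0 1) K"
  proof (rule continuous_from_closed_graph)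
    show "compact (u ` {0..L})" by (intro compact_continuous_image cont) auto
    show "K \<in> sphere 0 1 \<rightarrow> u ` {0..L}" unfolding sph using K by auto
    have "(\<lambda>x. (x, K x)) ` sphere 0 1 = (\<lambda>t. (\<theta> t, u t)) ` {0..L}"
      unfolding sph image_image by (intro image_cong) (use K in auto)
    moreover have "compact ((\<lambda>t. (\<theta> t, u t)) ` {0..L})" unfolding \<theta>_def
      by (intro compact_continuous_image continuous_intros cont) auto
    ultimately show "closed ((\<lambda>x. (x, K x)) ` sphere 0 1)"
      by (simp add: compact_imp_closed)
  qed
  have \<theta>: "\<theta> \<in> trig_poly L" "(\<lambda>t. cnj (\<theta> t)) \<in> trig_poly L"
    using trig_poly_char[of 1 L] by (simp_all add: \<theta>_def cnj_fourier_char[abs_def])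
  have Re: "P Re"
  proof -
    have "complex_of_real (Re (\<theta> t)) = 1 / 2 * (\<theta> t + cnj (\<theta> t))" for t
      by (simp add: complex_eq_iff)
    thus ?thesis unfolding P_def
      by (simp only:) (intro conjI continuous_intros trig_poly_mult trig_poly_const trig_poly_add \<theta>)
  qed
  have Im: "P Im"
  proof -
    have "complex_of_real (Im (\<theta> t)) = - \<i> / 2 * (\<theta> t + (-1) * cnj (\<theta> t))" for t
      by (simp add: complex_eq_iff)
    thus ?thesis unfolding P_def
      by (simp only:) (intro conjI continuous_intros trig_poly_mult trig_poly_const trig_poly_add \<theta>)
  qed
  have "\<exists>f. P f \<and> (\<forall>z\<in>sphere 0 1. \<bar>K z - f z\<bar> < e)"
  proof (rule Stone_Weierstrass_HOL)
    show "P (\<lambda>x. c)" for c by (simp add: P_def trig_poly_const)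
    show "continuous_on (sphere 0 1) f" if "P f" for f using that by (simp add: P_def)
    show "P (\<lambda>x. f x + g x)" if "P f \<and> P g" for f g
      using that by (simp add: P_def trig_poly_add continuous_on_add)
    show "P (\<lambda>x. f x * g x)" if "P f \<and> P g" for f g
      using that by (simp add: P_def trig_poly_mult continuous_on_mult)
    show "\<exists>f. P f \<and> f x \<noteq> f y" if "x \<in> sphere 0 1 \<and> y \<in> sphere 0 1 \<and> x \<noteq> y" for x y
      using Re Im that complex_eq_iff by blast
  qed (use contK e in auto)
  then obtain f where f: "P f" "\<And>z. z \<in> sphere 0 1 \<Longrightarrow> \<bar>K z - f z\<bar> < e" by auto
  have "cmod (of_real (u t) - of_real (f (\<theta> t))) < e" if "t \<in> {0..L}" for t
  proof -
    have "\<bar>K (\<theta> t) - f (\<theta> t)\<bar> < e" by (rule f(2)) (simp add: \<theta>_def)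
    thus ?thesis using K[OF that] by (metis norm_of_real of_real_diff)
  qed
  thus ?thesis using f(1) unfolding P_def by (intro bexI[of _ "\<lambda>t. of_real (f (\<theta> t))"]) auto
qed

lemma trig_poly_dense:
  fixes u :: "real \<Rightarrow> complex"
  assumes L: "L > 0" and cont: "continuous_on {0..L} u" and per: "u 0 = u L" and e: "e > 0"
  shows "\<exists>p\<in>trig_poly L. \<forall>t\<in>{0..L}. cmod (u t - p t) < e"
proof -
  obtain p where p: "p \<in> trig_poly L" "\<And>t. t \<in> {0..L} \<Longrightarrow> cmod (of_real (Re (u t)) - p t) < e / 2"
    using trig_poly_dense_real[OF L continuous_on_Re[OF cont] _ half_gt_zero[OF e]] per by auto
  obtain q where q: "q \<in> trig_poly L" "\<And>t. t \<in> {0..L} \<Longrightarrow> cmod (of_real (Im (u t)) - q t) < e / 2"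
    using trig_poly_dense_real[OF L continuous_on_Im[OF cont] _ half_gt_zero[OF e]] per by auto
  have "cmod (u t - (p t + \<i> * q t)) < e" if "t \<in> {0..L}" for t
  proof -
    have "u t - (p t + \<i> * q t) = (of_real (Re (u t)) - p t) + \<i> * (of_real (Im (u t)) - q t)"
      by (simp add: algebra_simps) (metis complex_eq add.commute)
    also have "cmod \<dots> \<le> cmod (of_real (Re (u t)) - p t) + cmod (of_real (Im (u t)) - q t)"
      by (rule order_trans[OF norm_triangle_ineq]) (simp add: norm_mult)
    also have "\<dots> < e" using p(2)[OF that] q(2)[OF that] by simp
    finally show ?thesis .
  qed
  thus ?thesis by (intro bexI[of _ "\<lambda>t. p t + \<i> * q t"] trig_poly_add trig_poly_mult trig_poly_const p q) auto
qed

text \<open>A measurable function is an almost-everywhere limit of continuous ones. These are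
  clipped, to have a common bound for dominated convergence, and damped near the endpoints, to
  become periodic; then uniform density applies.\<close>

lemma trig_poly_dense_L2:
  fixes h :: "real \<Rightarrow> complex"
  assumes L: "L > 0" and h [measurable]: "h \<in> borel_measurable borel"
    and B: "\<And>t. cmod (h t) \<le> B" and e: "e > 0"
  shows "\<exists>p\<in>trig_poly L. (\<integral>t. (cmod (h t - p t))\<^sup>2 \<partial>lborel_upto L) < e"
proof -
  \<comment> \<open>The added 1 keeps \<open>C\<close> positive when \<open>B\<close> is 0, so that
    the quotient in \<open>clip\<close> is continuous.\<close>
  define C where "C = B + 1"
  have C: "C > 0" "\<And>t. cmod (h t) \<le> C"
    using order_trans[OF norm_ge_zero B] order_trans[OF B, of C] by (auto simp: C_def)
  \<comment> \<open>The radial retraction onto the closed disc of radius \<open>C\<close>: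
    continuous, bounded by \<open>C\<close>, and the identity on the values of
    \<open>h\<close>.\<close>
  define clip where "clip z = (C / max C (cmod z)) *\<^sub>R z" for z
  have contclip: "continuous_on UNIV clip" unfolding clip_def
    using C(1) by (intro continuous_intros) auto
  have clip_le: "cmod (clip z) \<le> C" for z
    using C(1) by (auto simp: clip_def max_def field_simps)
  have clip_h: "clip (h t) = h t" for t
    using C(1) C(2)[of t] by (simp add: clip_def max_def)
  have "h \<in> borel_measurable lebesgue" by (simp add: measurable_completion)
  hence "h measurable_on UNIV" by (rule lebesgue_measurable_imp_measurable_on) auto
  then obtain N g where N: "negligible N" and g: "\<And>n. continuous_on UNIV (g n)"
    "\<And>t. t \<notin> N \<Longrightarrow> (\<lambda>n. g n t) \<longlonglongrightarrow> h t"
    unfolding measurable_on_def by auto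
  \<comment> \<open>A continuous cutoff that vanishes at 0 and L and equals 1 as soon as n t (L - t)
    is at least 1. Multiplying by it forces equal boundary values without changing the limit in the
    open interval.\<close>
  define \<phi> :: "nat \<Rightarrow> real \<Rightarrow> real" where "\<phi> n t = min 1 (max 0 (real n * (t * (L - t))))" for n t
  define u where "u n t = \<phi> n t *\<^sub>R clip (g n t)" for n t
  have contu: "continuous_on UNIV (u n)" for n unfolding u_def \<phi>_def
    by (intro continuous_intros continuous_on_compose2[OF contclip] g) auto
  have [measurable]: "u n \<in> borel_measurable borel" for n
    by (intro borel_measurable_continuous_onI contu)
  have u_le: "cmod (u n t) \<le> C" for n t
  proof -
    have "cmod (u n t) = \<phi> n t * cmod (clip (g n t))" by (simp add: u_def \<phi>_def)
    also have "\<dots> \<le> 1 * C" by (intro mult_mono clip_le) (auto simp: \<phi>_def)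
    finally show ?thesis by simp
  qed
  have u_lim: "(\<lambda>n. u n t) \<longlonglongrightarrow> h t" if "t \<notin> N" "0 < t" "t < L" for t
  proof -
    have "isCont clip (h t)" using contclip by (simp add: continuous_on_eq_continuous_at)
    hence *: "(\<lambda>n. clip (g n t)) \<longlonglongrightarrow> h t"
      using isCont_tendsto_compose[OF _ g(2)[OF that(1)], of clip] clip_h by simp
    have "filterlim (\<lambda>n. t * (L - t) * real n) at_top sequentially"
      by (intro filterlim_tendsto_pos_mult_at_top[OF tendsto_const] filterlim_real_sequentially)
         (use that in simp)
    hence "eventually (\<lambda>n. t * (L - t) * real n \<ge> 1) sequentially"
      by (simp add: filterlim_at_top)
    hence "eventually (\<lambda>n. \<phi> n t = 1) sequentially"
      by eventually_elim (auto simp: \<phi>_def mult_ac)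
    hence "(\<lambda>n. \<phi> n t) \<longlonglongrightarrow> 1" by (rule tendsto_eventually)
    from tendsto_scaleR[OF this *] show ?thesis by (simp add: u_def)
  qed
  \<comment> \<open>\<open>N\<close> is only known to be negligible for Lebesgue measure, whereas
    the statement needed is about \<open>lborel\<close>; hence the null superset
    \<open>N'\<close>.\<close>
  obtain N' where N': "N' \<in> null_sets lborel" "N \<subseteq> N'"
    using N unfolding negligible_iff_null_sets null_sets_completion_iff2 by blast
  have "N' \<union> {0, L} \<in> null_sets lborel"
    by (rule null_sets.Un[OF N'(1)]) (simp add: finite_imp_null_set_lborel)
  hence ae: "AE t in lborel. t \<notin> N' \<union> {0, L}" by (rule AE_not_in)
  have ae': "AE t in lborel_upto L. (\<lambda>n. (cmod (h t - u n t))\<^sup>2) \<longlonglongrightarrow> 0"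
  proof -
    have "AE t in lborel. t \<in> {0..L} \<longrightarrow> (\<lambda>n. (cmod (h t - u n t))\<^sup>2) \<longlonglongrightarrow> 0"
      using ae
    proof eventually_elim
      case (elim t)
      show ?case
      proof
        assume "t \<in> {0..L}"
        hence "(\<lambda>n. u n t) \<longlonglongrightarrow> h t" using elim N'(2) by (intro u_lim) auto
        from tendsto_power[OF tendsto_norm[OF tendsto_diff[OF tendsto_const[of "h t"] this]], of 2]
        show "(\<lambda>n. (cmod (h t - u n t))\<^sup>2) \<longlonglongrightarrow> 0" by simp
      qed
    qed
    thus ?thesis by (subst AE_restrict_space_iff) auto
  qed
  have bd: "(cmod (h t - u n t))\<^sup>2 \<le> (2 * C)\<^sup>2" for n t
    using norm_triangle_ineq4[of "h t" "u n t"] C(2)[of t] u_le[of n t]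
    by (intro power_mono) auto
  have int0: "integrable (lborel_upto L) (\<lambda>t. (2 * C)\<^sup>2)"
    by (rule integrable_lborel_upto_continuous[OF continuous_on_const])
  have "(\<lambda>n. \<integral>t. (cmod (h t - u n t))\<^sup>2 \<partial>lborel_upto L) \<longlonglongrightarrow> (\<integral>t. 0 \<partial>lborel_upto L)"
  proof (rule integral_dominated_convergence[where w = "\<lambda>t. (2 * C)\<^sup>2"])
    show "(\<lambda>t. (cmod (h t - u n t))\<^sup>2) \<in> borel_measurable (lborel_upto L)" for n
      by (rule borel_measurable_lborel_upto) measurable
    show "AE t in lborel_upto L. norm ((cmod (h t - u n t))\<^sup>2) \<le> (2 * C)\<^sup>2" for n
      unfolding real_norm_def abs_power2 by (intro AE_I2 bd)
  qed (use int0 ae' in simp_all)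
  hence "eventually (\<lambda>n. (\<integral>t. (cmod (h t - u n t))\<^sup>2 \<partial>lborel_upto L) < e / 4) sequentially"
    by (rule order_tendstoD(2)) (use e in simp)
  from eventually_happens'[OF sequentially_bot this]
  obtain n where n: "(\<integral>t. (cmod (h t - u n t))\<^sup>2 \<partial>lborel_upto L) < e / 4" by blast
  \<comment> \<open>Chosen so that 2 L d^2 = e/4. With (x + y)^2 \<le> 2 x^2 + 2 y^2 the total error
    stays below 2 (e/4) + e/4, which is less than e.\<close>
  define d where "d = sqrt (e / (8 * L))"
  have d: "d > 0" "d\<^sup>2 = e / (8 * L)" using e L by (auto simp: d_def)
  have "\<exists>p\<in>trig_poly L. \<forall>t\<in>{0..L}. cmod (u n t - p t) < d"
    by (rule trig_poly_dense[OF L continuous_on_subset[OF contu subset_UNIV] _ d(1)])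
       (simp add: u_def \<phi>_def)
  then obtain p where p: "p \<in> trig_poly L" "\<And>t. t \<in> {0..L} \<Longrightarrow> cmod (u n t - p t) < d" by blast
  obtain P where P: "\<And>t. cmod (p t) \<le> P" using trig_poly_bounded[OF p(1)] by blast
  have [measurable]: "p \<in> borel_measurable borel"
    by (rule borel_measurable_continuous_onI[OF trig_poly_continuous[OF p(1)]])
  have bd2: "(cmod (h t - p t))\<^sup>2 \<le> (C + P)\<^sup>2" for t
    using norm_triangle_ineq4[of "h t" "p t"] C(2)[of t] P[of t]
    by (intro power_mono) auto
  have int1: "integrable (lborel_upto L) (\<lambda>t. (cmod (h t - u n t))\<^sup>2)"
    by (rule integrable_lborel_upto[where B = "(2*C)\<^sup>2"]) (use bd in auto)
  have int2: "integrable (lborel_upto L) (\<lambda>t. 2 * d\<^sup>2)"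
    by (rule integrable_lborel_upto[where B = "2 * d\<^sup>2"]) auto
  have "(\<integral>t. (cmod (h t - p t))\<^sup>2 \<partial>lborel_upto L) \<le>
        (\<integral>t. 2 * (cmod (h t - u n t))\<^sup>2 + 2 * d\<^sup>2 \<partial>lborel_upto L)"
  proof (rule integral_mono)
    fix t assume "t \<in> space (lborel_upto L)"
    hence "cmod (u n t - p t) \<le> d" using p(2)[of t] by simp
    moreover have "cmod (h t - p t) \<le> cmod (h t - u n t) + cmod (u n t - p t)"
      using norm_triangle_ineq[of "h t - u n t" "u n t - p t"] by simp
    ultimately have "(cmod (h t - p t))\<^sup>2 \<le> (cmod (h t - u n t) + d)\<^sup>2"
      by (intro power_mono) auto
    also have "\<dots> \<le> 2 * (cmod (h t - u n t))\<^sup>2 + 2 * d\<^sup>2"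
      using zero_le_power2[of "cmod (h t - u n t) - d"] by (simp add: power2_sum power2_diff)
    finally show "(cmod (h t - p t))\<^sup>2 \<le> 2 * (cmod (h t - u n t))\<^sup>2 + 2 * d\<^sup>2" .
  qed (use bd2 int1 int2 in \<open>auto intro!: integrable_lborel_upto[where B = "(C + P)\<^sup>2"]\<close>)
  also have "\<dots> = 2 * (\<integral>t. (cmod (h t - u n t))\<^sup>2 \<partial>lborel_upto L) + L * (2 * d\<^sup>2)"
    using L int1 int2 by (simp add: integral_const_lborel_upto measure_lborel_upto)
  also have "L * (2 * d\<^sup>2) = e / 4" using d(2) L by simp
  also have "2 * (\<integral>t. (cmod (h t - u n t))\<^sup>2 \<partial>lborel_upto L) + e / 4 < e" using n e by simp
  finally show ?thesis using p(1) by blast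
qed

section \<open>Orthogonality, Bessel's inequality and Parseval's identity\<close>

lemma integral_norm_diff_trig:
  fixes h :: "real \<Rightarrow> complex" and c :: "int \<Rightarrow> complex"
  assumes L: "L > 0" and h [measurable]: "h \<in> borel_measurable borel"
    and B: "\<And>t. cmod (h t) \<le> B" and F: "finite F"
  defines "a \<equiv> \<lambda>n. \<integral>t. h t * cnj (fourier_char L n t) \<partial>lborel_upto L"
  shows "(\<integral>t. (cmod (h t - (\<Sum>n\<in>F. c n * fourier_char L n t)))\<^sup>2 \<partial>lborel_upto L) =
         (\<integral>t. (cmod (h t))\<^sup>2 \<partial>lborel_upto L) - 2 * Re (\<Sum>n\<in>F. cnj (c n) * a n) + L * (\<Sum>n\<in>F. (cmod (c n))\<^sup>2)"
proof -
  let ?M = "lborel_upto L" and ?e = "fourier_char L"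
  define p where "p t = (\<Sum>n\<in>F. c n * ?e n t)" for t
  have pm [measurable]: "p \<in> borel_measurable borel" unfolding p_def by measurable
  have "p \<in> trig_poly L" unfolding trig_poly_def p_def[abs_def] using F by auto
  then obtain P where P: "\<And>t. cmod (p t) \<le> P" by (rule trig_poly_bounded) blast
  have B0: "B \<ge> 0" using order_trans[OF norm_ge_zero B] .
  have P0: "P \<ge> 0" using order_trans[OF norm_ge_zero P] .
  have int: "integrable ?M (\<lambda>t. f t * cnj (g t))"
    if [measurable]: "f \<in> borel_measurable borel" "g \<in> borel_measurable borel"
    and "\<And>t. cmod (f t) \<le> X" "\<And>t. cmod (g t) \<le> Y" "X \<ge> 0" "Y \<ge> 0" for f g X Y
    by (rule integrable_lborel_upto[where B = "X * Y"]) (use that in \<open>auto simp: norm_mult intro!: mult_mono\<close>)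
  have int_he: "integrable ?M (\<lambda>t. h t * cnj (?e n t))" for n
    by (rule int[where X = B and Y = 1]) (use B B0 in auto)
  have int_ee: "integrable ?M (\<lambda>t. ?e n t * cnj (?e m t))" for n m
    by (rule int[where X = 1 and Y = 1]) auto
  have hp: "(\<integral>t. h t * cnj (p t) \<partial>?M) = (\<Sum>n\<in>F. cnj (c n) * a n)"
  proof -
    have "(\<integral>t. h t * cnj (p t) \<partial>?M) = (\<integral>t. (\<Sum>n\<in>F. cnj (c n) * (h t * cnj (?e n t))) \<partial>?M)"
      by (simp add: p_def sum_distrib_left mult_ac)
    also have "\<dots> = (\<Sum>n\<in>F. cnj (c n) * a n)" unfolding a_def
      by (subst Bochner_Integration.integral_sum) (use int_he in auto)
    finally show ?thesis .
  qed
  have ph: "(\<integral>t. p t * cnj (h t) \<partial>?M) = cnj (\<Sum>n\<in>F. cnj (c n) * a n)"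
  proof -
    have "(\<integral>t. p t * cnj (h t) \<partial>?M) = (\<integral>t. cnj (h t * cnj (p t)) \<partial>?M)"
      by (simp add: mult_ac)
    also have "\<dots> = cnj (\<integral>t. h t * cnj (p t) \<partial>?M)"
      by (rule Bochner_Integration.integral_cnj)
    finally show ?thesis unfolding hp .
  qed
  have pp: "(\<integral>t. p t * cnj (p t) \<partial>?M) = of_real (L * (\<Sum>n\<in>F. (cmod (c n))\<^sup>2))"
  proof -
    have "(\<integral>t. p t * cnj (p t) \<partial>?M) =
          (\<integral>t. (\<Sum>n\<in>F. \<Sum>m\<in>F. c n * cnj (c m) * (?e n t * cnj (?e m t))) \<partial>?M)"
      by (simp add: p_def sum_product mult_ac)
    also have "\<dots> = (\<Sum>n\<in>F. \<Sum>m\<in>F. c n * cnj (c m) * (if n = m then of_real L else 0))"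
      by (subst Bochner_Integration.integral_sum)
         (use int_ee in \<open>auto simp: Bochner_Integration.integral_sum integral_fourier_char_cnj[OF L]\<close>)
    also have "\<dots> = (\<Sum>n\<in>F. c n * cnj (c n) * of_real L)"
      using F by (intro sum.cong refl) (simp add: if_distrib sum.delta' cong: if_cong)
    finally show ?thesis by (simp add: complex_norm_square sum_distrib_left mult_ac flip: of_real_power)
  qed
  have hh: "(\<integral>t. h t * cnj (h t) \<partial>?M) = of_real (\<integral>t. (cmod (h t))\<^sup>2 \<partial>?M)"
    unfolding integral_complex_of_real[symmetric] complex_norm_square ..
  have "of_real (\<integral>t. (cmod (h t - p t))\<^sup>2 \<partial>?M) = (\<integral>t. (h t - p t) * cnj (h t - p t) \<partial>?M)"
    unfolding integral_complex_of_real[symmetric] complex_norm_square ..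
  also have "\<dots> = (\<integral>t. h t * cnj (h t) - h t * cnj (p t) - p t * cnj (h t) + p t * cnj (p t) \<partial>?M)"
    by (simp add: algebra_simps)
  also have "\<dots> = (\<integral>t. h t * cnj (h t) \<partial>?M) - (\<integral>t. h t * cnj (p t) \<partial>?M)
                    - (\<integral>t. p t * cnj (h t) \<partial>?M) + (\<integral>t. p t * cnj (p t) \<partial>?M)"
    using int[OF h h B B B0 B0] int[OF h pm B P B0 P0] int[OF pm h P B P0 B0] int[OF pm pm P P P0 P0]
    by (simp add: Bochner_Integration.integral_add Bochner_Integration.integral_diff)
  also have "\<dots> = of_real (\<integral>t. (cmod (h t))\<^sup>2 \<partial>?M)
      - ((\<Sum>n\<in>F. cnj (c n) * a n) + cnj (\<Sum>n\<in>F. cnj (c n) * a n)) + of_real (L * (\<Sum>n\<in>F. (cmod (c n))\<^sup>2))"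
    unfolding hh hp ph pp by simp
  also have "\<dots> = of_real ((\<integral>t. (cmod (h t))\<^sup>2 \<partial>?M) - 2 * Re (\<Sum>n\<in>F. cnj (c n) * a n)
      + L * (\<Sum>n\<in>F. (cmod (c n))\<^sup>2))"
    unfolding complex_add_cnj by simp
  finally show ?thesis unfolding p_def of_real_eq_iff .
qed

text \<open>The expansion of the squared distance with free coefficients serves both directions. The
  choice c n = a n / L gives Bessel's inequality. For the converse, a trigonometric polynomial close
  to \<open>h\<close> forces the partial sum over its own frequencies to exceed s - e, whatever its
  coefficients are. The factor L appears because the coefficients are not normalised.\<close>

lemma parseval:
  fixes h :: "real \<Rightarrow> complex"
  assumes L: "L > 0" and h: "h \<in> borel_measurable borel" and B: "\<And>t. cmod (h t) \<le> B"
  shows "((\<lambda>n. (cmod (\<integral>t. h t * cnj (fourier_char L n t) \<partial>lborel_upto L))\<^sup>2)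
            has_sum (L * (\<integral>t. (cmod (h t))\<^sup>2 \<partial>lborel_upto L))) UNIV"
proof -
  define a where "a n = (\<integral>t. h t * cnj (fourier_char L n t) \<partial>lborel_upto L)" for n
  define s where "s = L * (\<integral>t. (cmod (h t))\<^sup>2 \<partial>lborel_upto L)"
  let ?f = "\<lambda>n. (cmod (a n))\<^sup>2"
  note id = integral_norm_diff_trig[OF L h B, folded a_def]
  have le: "sum ?f F \<le> s" if "finite F" for F
  proof -
    have "0 \<le> (\<integral>t. (cmod (h t - (\<Sum>n\<in>F. (a n / L) * fourier_char L n t)))\<^sup>2 \<partial>lborel_upto L)"
      by (intro Bochner_Integration.integral_nonneg) auto
    also have "\<dots> = s / L - (\<Sum>n\<in>F. 2 * (?f n / L) - L * (?f n / L\<^sup>2))"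
    proof -
      have "Re (cnj (a n / L) * a n) = ?f n / L" for n
        by (simp add: mult.commute[of "cnj _"] flip: complex_norm_square of_real_power)
      thus ?thesis unfolding id[OF that]
        using L by (simp add: s_def sum_subtractf sum_distrib_left norm_divide power_divide)
    qed
    also have "(\<Sum>n\<in>F. 2 * (?f n / L) - L * (?f n / L\<^sup>2)) = sum ?f F / L"
      using L by (simp add: sum_divide_distrib power2_eq_square)
    finally show ?thesis using L by (simp add: field_simps)
  qed
  have ge: "\<exists>F. finite F \<and> sum ?f F > s - e" if "e > 0" for e
  proof -
    obtain p where p: "p \<in> trig_poly L" "(\<integral>t. (cmod (h t - p t))\<^sup>2 \<partial>lborel_upto L) < e / L"
      using trig_poly_dense_L2[OF L h B, of "e / L"] \<open>e > 0\<close> L by auto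
    from p(1) obtain F c where F: "finite F" "p = (\<lambda>t. \<Sum>n\<in>F. c n * fourier_char L n t)"
      by (rule trig_polyE)
    \<comment> \<open>Completing the square: as a function of c n the right side is smallest at c n
      = a n / L, where it takes the value on the left.\<close>
    have "- (?f n / L) \<le> - 2 * Re (cnj (c n) * a n) + L * (cmod (c n))\<^sup>2" for n
    proof -
      have "2 * Re (cnj (c n) * a n) \<le> 2 * (cmod (c n) * cmod (a n))"
        using complex_Re_le_cmod[of "cnj (c n) * a n"] by (simp add: norm_mult)
      also have "\<dots> \<le> ?f n / L + L * (cmod (c n))\<^sup>2"
      proof -
        have "0 \<le> (cmod (a n) - L * cmod (c n))\<^sup>2 / L" using L by simp
        also have "\<dots> = ?f n / L + L * (cmod (c n))\<^sup>2 - 2 * (cmod (c n) * cmod (a n))"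
          using L by (simp add: power2_eq_square field_simps)
        finally show ?thesis by simp
      qed
      finally show ?thesis by simp
    qed
    hence "(\<Sum>n\<in>F. - (?f n / L)) \<le> (\<Sum>n\<in>F. - 2 * Re (cnj (c n) * a n) + L * (cmod (c n))\<^sup>2)"
      by (rule sum_mono)
    also have "\<dots> = - 2 * Re (\<Sum>n\<in>F. cnj (c n) * a n) + L * (\<Sum>n\<in>F. (cmod (c n))\<^sup>2)"
      unfolding sum.distrib Re_sum sum_distrib_left by simp
    also have "\<dots> < e / L - s / L"
      using p(2) L unfolding F(2) id[OF F(1)] by (simp add: s_def)
    finally have "s - e < sum ?f F"
      using L by (simp add: sum_negf field_simps flip: sum_divide_distrib)
    thus ?thesis using F(1) by blast
  qed
  let ?S = "{F :: int set. finite F \<and> F \<subseteq> UNIV}"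
  have bdd: "bdd_above (sum ?f ` ?S)" by (rule bdd_aboveI[of _ s]) (use le in auto)
  have "(SUP F\<in>?S. sum ?f F) = s"
  proof (rule antisym)
    show "(SUP F\<in>?S. sum ?f F) \<le> s" by (rule cSUP_least) (use le in auto)
    show "s \<le> (SUP F\<in>?S. sum ?f F)"
    proof (rule field_le_epsilon)
      fix e :: real assume "e > 0"
      then obtain F where F: "finite F" "sum ?f F > s - e" using ge by blast
      have "sum ?f F \<le> (SUP F\<in>?S. sum ?f F)" by (rule cSUP_upper[OF _ bdd]) (use F in auto)
      thus "s \<le> (SUP F\<in>?S. sum ?f F) + e" using F(2) by simp
    qed
  qed
  moreover have "(?f has_sum (SUP F\<in>?S. sum ?f F)) UNIV"
    by (rule nonneg_bdd_above_has_sum) (use bdd in \<open>auto simp: conj_commute\<close>)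
  ultimately show ?thesis by (simp add: a_def s_def)
qed

text \<open>The functions to which this is applied contain factors exp (-2 \<pi> w t), which are
  unbounded on the line. Cutting off outside [0, L] restores boundedness and changes none of the
  integrals.\<close>

lemma parseval_continuous:
  fixes h :: "real \<Rightarrow> complex"
  assumes L: "L > 0" and h: "continuous_on UNIV h"
  shows "((\<lambda>n. (cmod (\<integral>t. h t * cnj (fourier_char L n t) \<partial>lborel_upto L))\<^sup>2)
            has_sum (L * (\<integral>t. (cmod (h t))\<^sup>2 \<partial>lborel_upto L))) UNIV"
proof -
  define h' where "h' t = indicator {0..L} t *\<^sub>R h t" for t
  have [measurable]: "h \<in> borel_measurable borel"
    by (rule borel_measurable_continuous_onI[OF h])
  have "h' \<in> borel_measurable borel" unfolding h'_def by measurable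
  have "compact (h ` {0..L})"
    by (intro compact_continuous_image continuous_on_subset[OF h]) auto
  then obtain B where B: "\<And>t. t \<in> {0..L} \<Longrightarrow> norm (h t) \<le> B"
    using compact_imp_bounded bounded_iff by (metis imageI)
  have "cmod (h' t) \<le> max B 0" for t
    using B[of t] by (auto simp: h'_def indicator_def)
  from parseval[OF L \<open>h' \<in> _\<close> this] have
    "((\<lambda>n. (cmod (\<integral>t. h' t * cnj (fourier_char L n t) \<partial>lborel_upto L))\<^sup>2)
            has_sum (L * (\<integral>t. (cmod (h' t))\<^sup>2 \<partial>lborel_upto L))) UNIV" .
  moreover have "(\<integral>t. h' t * cnj (fourier_char L n t) \<partial>lborel_upto L) =
                 (\<integral>t. h t * cnj (fourier_char L n t) \<partial>lborel_upto L)" for n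
    by (rule Bochner_Integration.integral_cong) (auto simp: h'_def)
  moreover have "(\<integral>t. (cmod (h' t))\<^sup>2 \<partial>lborel_upto L) = (\<integral>t. (cmod (h t))\<^sup>2 \<partial>lborel_upto L)"
    by (rule Bochner_Integration.integral_cong) (auto simp: h'_def)
  ultimately show ?thesis by simp
qed

section \<open>Periodization\<close>

text \<open>Enumerating the integers by \<open>int_decode\<close> turns the integral into a series
  over the naturals.\<close>

lemma borel_measurable_nn_integral_count_space_int [measurable (raw)]:
  fixes F :: "'a \<Rightarrow> int \<Rightarrow> ennreal"
  assumes [measurable]: "\<And>j. (\<lambda>t. F t j) \<in> borel_measurable M"
  shows "(\<lambda>t. \<integral>\<^sup>+j. F t j \<partial>count_space UNIV) \<in> borel_measurable M"
proof -
  have "(\<integral>\<^sup>+j. F t j \<partial>count_space UNIV) = (\<Sum>i. F t (int_decode i))" for t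
    unfolding nn_integral_count_space_nat[symmetric]
    by (rule nn_integral_bij_count_space[OF bij_int_decode, symmetric])
  thus ?thesis by simp
qed

text \<open>Translates of the half-open interval tile the line exactly, while those of the closed
  one overlap; the endpoint is a null set. This passage makes the index sets in the tiling arguments
  exact.\<close>

lemma nn_integral_lborel_upto:
  assumes [measurable]: "F \<in> borel_measurable borel"
  shows "(\<integral>\<^sup>+t. F t \<partial>lborel_upto L) = (\<integral>\<^sup>+t. F t * indicator {0..<L} t \<partial>lborel)"
proof -
  have "AE t in lborel. t \<noteq> L" by (rule AE_lborel_singleton)
  hence "(\<integral>\<^sup>+t. F t * indicator {0..L} t \<partial>lborel) = (\<integral>\<^sup>+t. F t * indicator {0..<L} t \<partial>lborel)"
    by (intro nn_integral_cong_AE) (auto elim!: eventually_mono simp: indicator_def)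
  thus ?thesis by (simp add: nn_integral_restrict_space)
qed

text \<open>Each t lies in exactly one tile, with index \<open>\<lfloor>t / L\<rfloor>\<close>.
  Working in the extended non-negative reals lets Tonelli swap sum and integral with no
  integrability condition.\<close>

lemma nn_integral_periodize:
  fixes F :: "real \<Rightarrow> ennreal"
  assumes L: "L > 0" and [measurable]: "F \<in> borel_measurable borel"
  shows "(\<integral>\<^sup>+t. F t \<partial>lborel) =
         (\<integral>\<^sup>+t. (\<integral>\<^sup>+j. F (t + real_of_int j * L) \<partial>count_space UNIV) \<partial>lborel_upto L)"
proof -
  have "F t = (\<integral>\<^sup>+j. F t * indicator {real_of_int j * L..<(real_of_int j + 1) * L} t \<partial>count_space UNIV)" for t
  proof -
    have "t \<in> {real_of_int j * L..<(real_of_int j + 1) * L} \<longleftrightarrow> j = \<lfloor>t / L\<rfloor>" for j :: int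
      using L by (auto simp: floor_eq_iff field_simps eq_commute[of j])
    hence "(\<integral>\<^sup>+j. F t * indicator {real_of_int j * L..<(real_of_int j + 1) * L} t \<partial>count_space UNIV) =
           (\<Sum>j\<in>{\<lfloor>t / L\<rfloor>}. F t * indicator {real_of_int j * L..<(real_of_int j + 1) * L} t)"
      by (intro nn_integral_count_space') (auto simp: indicator_def)
    moreover have "t \<in> {real_of_int \<lfloor>t / L\<rfloor> * L..<(real_of_int \<lfloor>t / L\<rfloor> + 1) * L}"
      using L by (simp add: floor_divide_lower floor_divide_upper)
    ultimately show ?thesis by (simp only: sum.insert sum.empty finite.emptyI) simp
  qed
  hence "(\<integral>\<^sup>+t. F t \<partial>lborel) =
     (\<integral>\<^sup>+t. (\<integral>\<^sup>+j. F t * indicator {real_of_int j * L..<(real_of_int j + 1) * L} t \<partial>count_space UNIV) \<partial>lborel)"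
    by simp
  also have "\<dots> = (\<integral>\<^sup>+j. (\<integral>\<^sup>+t. F t * indicator {real_of_int j * L..<(real_of_int j + 1) * L} t \<partial>lborel) \<partial>count_space UNIV)"
    by (rule nn_integral_count_space_nn_integral) auto
  also have "\<dots> = (\<integral>\<^sup>+j. (\<integral>\<^sup>+t. F (t + real_of_int j * L) * indicator {0..<L} t \<partial>lborel) \<partial>count_space UNIV)"
  proof (rule nn_integral_cong)
    fix j :: int
    have "(\<integral>\<^sup>+t. F t * indicator {real_of_int j * L..<(real_of_int j + 1) * L} t \<partial>lborel) =
      (\<integral>\<^sup>+t. F (real_of_int j * L + 1 * t) * indicator {real_of_int j * L..<(real_of_int j + 1) * L} (real_of_int j * L + 1 * t) \<partial>lborel)"
      by (subst nn_integral_real_affine[of _ 1 "real_of_int j * L"]) auto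
    also have "\<dots> = (\<integral>\<^sup>+t. F (t + real_of_int j * L) * indicator {0..<L} t \<partial>lborel)"
      by (intro nn_integral_cong) (auto simp: indicator_def algebra_simps)
    finally show "(\<integral>\<^sup>+t. F t * indicator {real_of_int j * L..<(real_of_int j + 1) * L} t \<partial>lborel) =
      (\<integral>\<^sup>+t. F (t + real_of_int j * L) * indicator {0..<L} t \<partial>lborel)" .
  qed
  also have "\<dots> = (\<integral>\<^sup>+j. (\<integral>\<^sup>+t. F (t + real_of_int j * L) \<partial>lborel_upto L) \<partial>count_space UNIV)"
    by (subst nn_integral_lborel_upto) auto
  also have "\<dots> = (\<integral>\<^sup>+t. (\<integral>\<^sup>+j. F (t + real_of_int j * L) \<partial>count_space UNIV) \<partial>lborel_upto L)"
    by (rule nn_integral_count_space_nn_integral[symmetric]) auto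
  finally show ?thesis .
qed

text \<open>Periodizing \<open>F\<close> times the indicator of [0, n L) leaves only the translates
  0, ..., n - 1. For periodic \<open>F\<close> this yields n equal contributions (upper bound); in
  general it brings the n equally spaced points together under one integral (lower bound).\<close>

lemma nn_integral_lborel_upto_mult:
  fixes F :: "real \<Rightarrow> ennreal"
  assumes L: "L > 0" and [measurable]: "F \<in> borel_measurable borel"
  shows "(\<integral>\<^sup>+t. F t \<partial>lborel_upto (real n * L)) =
         (\<integral>\<^sup>+t. (\<Sum>l<n. F (t + real l * L)) \<partial>lborel_upto L)"
proof -
  have "(\<integral>\<^sup>+t. F t \<partial>lborel_upto (real n * L)) = (\<integral>\<^sup>+t. F t * indicator {0..<real n * L} t \<partial>lborel)"
    by (simp add: nn_integral_lborel_upto)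
  also have "\<dots> = (\<integral>\<^sup>+t. (\<integral>\<^sup>+j. F (t + real_of_int j * L) * indicator {0..<real n * L} (t + real_of_int j * L)
                    \<partial>count_space UNIV) \<partial>lborel_upto L)"
    by (rule nn_integral_periodize[OF L]) auto
  also have "\<dots> = (\<integral>\<^sup>+t. (\<integral>\<^sup>+j. F (t + real_of_int j * L) * indicator {0..<real n * L} (t + real_of_int j * L)
                    \<partial>count_space UNIV) * indicator {0..<L} t \<partial>lborel)"
    by (rule nn_integral_lborel_upto) measurable
  also have "\<dots> = (\<integral>\<^sup>+t. (\<Sum>l<n. F (t + real l * L)) * indicator {0..<L} t \<partial>lborel)"
  proof (intro nn_integral_cong)
    fix t
    show "(\<integral>\<^sup>+j. F (t + real_of_int j * L) * indicator {0..<real n * L} (t + real_of_int j * L)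
                    \<partial>count_space UNIV) * indicator {0..<L} t = (\<Sum>l<n. F (t + real l * L)) * indicator {0..<L} t"
    proof (cases "t \<in> {0..<L}")
      case True
      have *: "t + real_of_int j * L \<in> {0..<real n * L} \<longleftrightarrow> j \<in> int ` {..<n}" for j
      proof
        assume A: "t + real_of_int j * L \<in> {0..<real n * L}"
        hence "(real_of_int j + 1) * L > 0" using True by (auto simp: algebra_simps)
        hence "j \<ge> 0" using L by (simp add: zero_less_mult_iff)
        moreover have "real_of_int j * L < real n * L"
          using A True unfolding atLeastLessThan_iff by linarith
        hence "j < int n" using L by simp
        ultimately show "j \<in> int ` {..<n}" by (auto simp: image_iff intro!: bexI[of _ "nat j"])
      next
        assume "j \<in> int ` {..<n}"
        then obtain l where l: "j = int l" "l < n" by auto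
        hence "real l + 1 \<le> real n" by simp
        hence "(real l + 1) * L \<le> real n * L" using L by simp
        thus "t + real_of_int j * L \<in> {0..<real n * L}" using True l L by (auto simp: algebra_simps)
      qed
      have "(\<integral>\<^sup>+j. F (t + real_of_int j * L) * indicator {0..<real n * L} (t + real_of_int j * L) \<partial>count_space UNIV)
            = (\<Sum>j\<in>int ` {..<n}. F (t + real_of_int j * L) * indicator {0..<real n * L} (t + real_of_int j * L))"
        by (intro nn_integral_count_space') (use * in \<open>auto simp: indicator_def\<close>)
      also have "\<dots> = (\<Sum>j\<in>int ` {..<n}. F (t + real_of_int j * L))"
        by (intro sum.cong refl) (use * in \<open>auto simp: indicator_def\<close>)
      also have "\<dots> = (\<Sum>l<n. F (t + real l * L))"
        by (subst sum.reindex) auto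
      finally show ?thesis by simp
    qed auto
  qed
  also have "\<dots> = (\<integral>\<^sup>+t. (\<Sum>l<n. F (t + real l * L)) \<partial>lborel_upto L)"
    by (rule nn_integral_lborel_upto[symmetric]) measurable
  finally show ?thesis .
qed

section \<open>Sampling bounds for sums of simple fractions\<close>

text \<open>
  The normalisation that makes the Fourier coefficients of exp (2 \<pi> i s t) on [0, 1/\<alpha>] equal to
  1/(s + \<alpha> m).
\<close>

definition pole_factor :: "real \<Rightarrow> complex \<Rightarrow> complex" where
  "pole_factor \<alpha> s = 2 * of_real pi * \<i> / (exp (2 * of_real pi * \<i> * s / of_real \<alpha>) - 1)"

lemma norm_exp_pole:
  "cmod (exp (2 * of_real pi * \<i> * s / of_real \<alpha>)) = exp (- 2 * pi * Im s / \<alpha>)"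
  by (simp add: norm_exp_eq_Re Re_divide_of_real)

text \<open>The modulus of the exponential depends on Im s alone, and ||E| - 1| \<le> |E - 1| \<le>
  |E| + 1. The bounds are therefore uniform in Re s, and they are non-degenerate because Im s
  \<noteq> 0 moves |E| away from 1.\<close>

lemma pole_factor_bounds:
  assumes "\<alpha> > 0" "Im s \<noteq> 0"
  defines "\<rho> \<equiv> exp (- 2 * pi * Im s / \<alpha>)"
  shows "exp (2 * of_real pi * \<i> * s / of_real \<alpha>) \<noteq> 1" "\<rho> \<noteq> 1"
    "2 * pi / (1 + \<rho>) \<le> cmod (pole_factor \<alpha> s)" "cmod (pole_factor \<alpha> s) \<le> 2 * pi / \<bar>1 - \<rho>\<bar>"
proof -
  let ?E = "exp (2 * of_real pi * \<i> * s / of_real \<alpha>)"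
  have nE: "cmod ?E = \<rho>" unfolding \<rho>_def by (rule norm_exp_pole)
  show \<rho>: "\<rho> \<noteq> 1" using assms by (simp add: \<rho>_def)
  thus E: "?E \<noteq> 1" using nE norm_one by metis
  have up: "cmod (?E - 1) \<le> 1 + \<rho>" using norm_triangle_ineq4[of ?E 1] nE by simp
  have low: "\<bar>1 - \<rho>\<bar> \<le> cmod (?E - 1)" using norm_triangle_ineq3[of ?E 1] nE by simp
  have nf: "cmod (pole_factor \<alpha> s) = 2 * pi / cmod (?E - 1)"
    by (simp add: pole_factor_def norm_divide norm_mult)
  show "2 * pi / (1 + \<rho>) \<le> cmod (pole_factor \<alpha> s)" unfolding nf
    by (rule divide_left_mono[OF up]) (use E in \<open>auto intro!: mult_pos_pos simp: \<rho>_def add_pos_pos\<close>)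
  show "cmod (pole_factor \<alpha> s) \<le> 2 * pi / \<bar>1 - \<rho>\<bar>" unfolding nf
    by (rule divide_left_mono[OF low]) (use E \<rho> in \<open>auto intro!: mult_pos_pos\<close>)
qed

text \<open>With z = 2 \<pi> i (s + \<alpha> m), the boundary value exp (z/\<alpha>) does not depend
  on the integer m. Hence one normalising factor cancels the numerator for all m at once.\<close>

lemma integral_pole:
  assumes \<alpha>: "\<alpha> > 0" and s: "Im s \<noteq> 0"
  shows "(\<integral>t. pole_factor \<alpha> s * exp (2 * of_real pi * \<i> * s * of_real t) * fourier_char (1 / \<alpha>) m t
            \<partial>lborel_upto (1 / \<alpha>)) = 1 / (s + of_real (\<alpha> * of_int m))"
proof -
  define z where "z = 2 * of_real pi * \<i> * (s + of_real (\<alpha> * of_int m))"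
  have sm: "s + of_real (\<alpha> * of_int m) \<noteq> 0" using s by (auto simp: complex_eq_iff)
  hence z: "z \<noteq> 0" by (simp add: z_def)
  have "exp (2 * of_real pi * \<i> * s * of_real t) * fourier_char (1 / \<alpha>) m t = exp (z * of_real t)" for t
    using \<alpha> unfolding fourier_char_eq_exp z_def exp_add[symmetric] by (simp add: field_simps)
  hence "(\<integral>t. pole_factor \<alpha> s * exp (2 * of_real pi * \<i> * s * of_real t) * fourier_char (1 / \<alpha>) m t
            \<partial>lborel_upto (1 / \<alpha>)) = pole_factor \<alpha> s * (\<integral>t. exp (z * of_real t) \<partial>lborel_upto (1 / \<alpha>))"
    by (simp add: mult.assoc)
  also have "\<dots> = pole_factor \<alpha> s * ((exp (z * of_real (1 / \<alpha>)) - 1) / z)"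
    using \<alpha> by (subst integral_exp_lborel_upto[OF z]) auto
  also have "z * of_real (1 / \<alpha>) = 2 * of_real pi * \<i> * s / of_real \<alpha> + \<i> * (of_int m * (of_real pi * 2))"
    using \<alpha> by (simp add: z_def field_simps)
  also have "exp \<dots> = exp (2 * of_real pi * \<i> * s / of_real \<alpha>)"
    by (simp add: exp_add exp_integer_2pi mult_ac)
  also have "pole_factor \<alpha> s * ((\<dots> - 1) / z) = 1 / (s + of_real (\<alpha> * of_int m))"
    using pole_factor_bounds(1)[OF \<alpha> s] sm by (simp add: pole_factor_def z_def)
  finally show ?thesis .
qed

section \<open>Interpolation at distinct nodes and the Vandermonde bound\<close>

lemma lagrange_coeffs:
  fixes \<mu> :: "'k \<Rightarrow> 'a::field"
  assumes K: "finite K" "inj_on \<mu> K" "k0 \<in> K"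
  shows "\<exists>r. \<forall>k\<in>K. (\<Sum>l<card K. r l * \<mu> k ^ l) = (if k = k0 then 1 else 0)"
proof -
  \<comment> \<open>The Lagrange basis polynomial of the node \<open>\<mu> k0\<close>; its degree is
    below \<open>card K\<close>, and the \<open>r l\<close> are its coefficients.\<close>
  define Q where "Q = (\<Prod>k\<in>K - {k0}. smult (inverse (\<mu> k0 - \<mu> k)) [:- \<mu> k, 1:])"
  have "degree Q \<le> (\<Sum>k\<in>K - {k0}. degree (smult (inverse (\<mu> k0 - \<mu> k)) [:- \<mu> k, 1:]))"
    unfolding Q_def using degree_prod_sum_le[OF finite_Diff[OF K(1)]] unfolding comp_def by blast
  also have "\<dots> \<le> (\<Sum>k\<in>K - {k0}. 1)"
    by (intro sum_mono) (simp add: order_trans[OF degree_smult_le])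
  also have "\<dots> < card K" using card_Diff1_less[OF K(1) K(3)] by simp
  finally have deg: "degree Q < card K" .
  have "(\<Sum>l<card K. coeff Q l * \<mu> k ^ l) = (if k = k0 then 1 else 0)" if "k \<in> K" for k
  proof -
    have "(\<Sum>l<card K. coeff Q l * \<mu> k ^ l) = poly Q (\<mu> k)" unfolding poly_altdef
      using deg by (intro sum.mono_neutral_right) (auto simp: coeff_eq_0)
    also have "\<dots> = (\<Prod>i\<in>K - {k0}. inverse (\<mu> k0 - \<mu> i) * (\<mu> k - \<mu> i))"
      by (simp add: Q_def poly_prod algebra_simps)
    also have "\<dots> = (if k = k0 then 1 else 0)"
    proof (cases "k = k0")
      case True
      have "\<mu> k0 \<noteq> \<mu> i" if "i \<in> K - {k0}" for i using that K by (auto simp: inj_on_def)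
      thus ?thesis using True by (intro trans[OF prod.neutral]) auto
    next
      case False
      thus ?thesis using K that by (auto intro!: prod_zero bexI[of _ k])
    qed
    finally show ?thesis .
  qed
  thus ?thesis by blast
qed

text \<open>Combining the rows with the Lagrange coefficients isolates \<open>b k0\<close>, and
  Cauchy-Schwarz bounds the combination. The constant depends on the nodes only, so it is uniform in
  \<open>b\<close>; writing 1 + R in the denominator keeps it positive without a separate argument
  that R > 0.\<close>

lemma vandermonde_lower_bound:
  fixes \<mu> :: "'k \<Rightarrow> complex"
  assumes K: "finite K" "inj_on \<mu> K" "k0 \<in> K"
  shows "\<exists>\<delta>>0. \<forall>b. \<delta> * (cmod (b k0))\<^sup>2 \<le> (\<Sum>l<card K. (cmod (\<Sum>k\<in>K. \<mu> k ^ l * b k))\<^sup>2)"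
proof -
  obtain r where r: "\<And>k. k \<in> K \<Longrightarrow> (\<Sum>l<card K. r l * \<mu> k ^ l) = (if k = k0 then 1 else 0)"
    using lagrange_coeffs[OF K] by blast
  define R where "R = (\<Sum>l<card K. (cmod (r l))\<^sup>2)"
  have R: "R \<ge> 0" unfolding R_def by (intro sum_nonneg) auto
  have "1 / (1 + R) * (cmod (b k0))\<^sup>2 \<le> (\<Sum>l<card K. (cmod (\<Sum>k\<in>K. \<mu> k ^ l * b k))\<^sup>2)" for b
  proof -
    let ?S = "\<lambda>l. \<Sum>k\<in>K. \<mu> k ^ l * b k"
    have "(\<Sum>l<card K. r l * ?S l) = (\<Sum>k\<in>K. (\<Sum>l<card K. r l * \<mu> k ^ l) * b k)"
      unfolding sum_distrib_left sum_distrib_right by (subst sum.swap) (simp add: mult.assoc)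
    also have "\<dots> = b k0" using K by (simp add: r if_distrib[of "\<lambda>x. x * _"] sum.delta cong: if_cong)
    finally have "cmod (b k0) \<le> (\<Sum>l<card K. cmod (r l) * cmod (?S l))"
      by (metis (no_types, lifting) norm_mult norm_sum sum.cong)
    hence "(cmod (b k0))\<^sup>2 \<le> (\<Sum>l<card K. cmod (r l) * cmod (?S l))\<^sup>2" by (rule power_mono) auto
    also have "\<dots> \<le> R * (\<Sum>l<card K. (cmod (?S l))\<^sup>2)" unfolding R_def by (rule Cauchy_Schwarz_ineq_sum)
    also have "\<dots> \<le> (1 + R) * (\<Sum>l<card K. (cmod (?S l))\<^sup>2)"
      by (intro mult_right_mono sum_nonneg) auto
    finally show ?thesis using R by (simp add: field_simps)
  qed
  thus ?thesis using R by (intro exI[of _ "1 / (1 + R)"]) auto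
qed

text \<open>
  Poles of the shifted windows at fixed w lie on a horizontal row; their joint contribution,
  stripped of the factor exp (-2 \<pi> w t) and of a unimodular one, is \<beta>-periodic.
\<close>

definition comb_part :: "real \<Rightarrow> real \<Rightarrow> int set \<Rightarrow> (int \<Rightarrow> complex) \<Rightarrow> real \<Rightarrow> complex \<Rightarrow> real \<Rightarrow> complex" where
  "comb_part \<alpha> \<beta> J c x w t =
     (\<Sum>j\<in>J. c j * pole_factor \<alpha> (\<i> * w - of_real (x + of_int j / \<beta>)) * cnj (fourier_char \<beta> j t))"

lemma comb_part_period:
  "\<beta> \<noteq> 0 \<Longrightarrow> comb_part \<alpha> \<beta> J c x w (t + real l * \<beta>) = comb_part \<alpha> \<beta> J c x w t"
  using fourier_char_period[of \<beta> _ t "int l"] by (simp add: comb_part_def)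

lemma continuous_on_comb_part [continuous_intros]: "continuous_on A (comb_part \<alpha> \<beta> J c x w)"
  unfolding comb_part_def[abs_def] by (intro continuous_intros)

lemma ennreal_integral_continuous:
  fixes f :: "real \<Rightarrow> real"
  assumes "continuous_on UNIV f" "\<And>t. f t \<ge> 0"
  shows "(\<integral>\<^sup>+t. ennreal (f t) \<partial>lborel_upto L) = ennreal (\<integral>t. f t \<partial>lborel_upto L)"
  by (rule nn_integral_eq_integral[OF integrable_lborel_upto_continuous[OF assms(1)]]) (use assms in auto)

lemma nn_integral_comb_part:
  assumes "\<beta> > 0" "finite J"
  shows "(\<integral>\<^sup>+t. ennreal ((cmod (comb_part \<alpha> \<beta> J c x w t))\<^sup>2) \<partial>lborel_upto \<beta>) =
    ennreal (\<beta> * (\<Sum>j\<in>J. (cmod (c j) * cmod (pole_factor \<alpha> (\<i> * w - of_real (x + of_int j / \<beta>))))\<^sup>2))"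
proof -
  \<comment> \<open>The conjugate turns conjugated characters back into characters, and the sign
    fits the form h - p with h = 0. The squared-distance expansion then reduces to
    orthogonality.\<close>
  let ?d = "\<lambda>j. - cnj (c j * pole_factor \<alpha> (\<i> * w - of_real (x + of_int j / \<beta>)))"
  have *: "cmod (comb_part \<alpha> \<beta> J c x w t) = cmod (0 - (\<Sum>j\<in>J. ?d j * fourier_char \<beta> j t))" for t
  proof -
    have "0 - (\<Sum>j\<in>J. ?d j * fourier_char \<beta> j t) = cnj (comb_part \<alpha> \<beta> J c x w t)"
      by (simp add: comb_part_def sum_negf)
    thus ?thesis by simp
  qed
  have "(\<integral>\<^sup>+t. ennreal ((cmod (comb_part \<alpha> \<beta> J c x w t))\<^sup>2) \<partial>lborel_upto \<beta>) =
        ennreal (\<integral>t. (cmod (comb_part \<alpha> \<beta> J c x w t))\<^sup>2 \<partial>lborel_upto \<beta>)"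
    by (intro ennreal_integral_continuous continuous_intros) auto
  also have "(\<integral>t. (cmod (comb_part \<alpha> \<beta> J c x w t))\<^sup>2 \<partial>lborel_upto \<beta>) = \<beta> * (\<Sum>j\<in>J. (cmod (?d j))\<^sup>2)"
    unfolding * by (subst integral_norm_diff_trig[OF assms(1) _ _ assms(2), of _ 0]) auto
  finally show ?thesis by (simp add: norm_mult)
qed

text \<open>The order of quantifiers is the point: \<open>p\<close> and \<open>P\<close> are fixed
  before \<open>J\<close>, \<open>c\<close> and \<open>x\<close>. This works because Im (i w - y) =
  Re w for every real y, so all terms of the row share the same bounds \<open>lo\<close> and
  \<open>hi\<close>.\<close>

lemma nn_integral_comb_part_bounds:
  assumes "\<alpha> > 0" "\<beta> > 0" "Re w \<noteq> 0"
  shows "\<exists>p P. 0 < p \<and> 0 < P \<and> (\<forall>J c x. finite J \<longrightarrow>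
     ennreal (p * (\<Sum>j\<in>J. (cmod (c j))\<^sup>2)) \<le> (\<integral>\<^sup>+t. ennreal ((cmod (comb_part \<alpha> \<beta> J c x w t))\<^sup>2) \<partial>lborel_upto \<beta>) \<and>
     (\<integral>\<^sup>+t. ennreal ((cmod (comb_part \<alpha> \<beta> J c x w t))\<^sup>2) \<partial>lborel_upto \<beta>) \<le> ennreal (P * (\<Sum>j\<in>J. (cmod (c j))\<^sup>2)))"
proof -
  define \<rho> where "\<rho> = exp (- 2 * pi * Re w / \<alpha>)"
  define lo where "lo = 2 * pi / (1 + \<rho>)"
  define hi where "hi = 2 * pi / \<bar>1 - \<rho>\<bar>"
  have b: "lo \<le> cmod (pole_factor \<alpha> (\<i> * w - of_real y))" "cmod (pole_factor \<alpha> (\<i> * w - of_real y)) \<le> hi" "\<rho> \<noteq> 1" for y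
    using pole_factor_bounds[OF assms(1), of "\<i> * w - of_real y"] assms(3)
    by (auto simp: lo_def hi_def \<rho>_def)
  have pos: "lo > 0" "hi > 0" using b(3) by (auto simp: lo_def hi_def \<rho>_def intro!: divide_pos_pos add_pos_pos)
  show ?thesis
  proof (rule exI[of _ "\<beta> * lo\<^sup>2"], rule exI[of _ "\<beta> * hi\<^sup>2"], intro conjI allI impI)
    fix J :: "int set" and c :: "int \<Rightarrow> complex" and x :: real
    assume J: "finite J"
    have 1: "lo\<^sup>2 * (\<Sum>j\<in>J. (cmod (c j))\<^sup>2) \<le> (\<Sum>j\<in>J. (cmod (c j) * cmod (pole_factor \<alpha> (\<i> * w - of_real (x + of_int j / \<beta>))))\<^sup>2)"
      unfolding sum_distrib_left power_mult_distrib
      by (intro sum_mono) (use b(1) pos in \<open>auto simp: mult.commute[of "lo\<^sup>2"]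
          simp del: of_real_add intro!: mult_left_mono power_mono\<close>)
    have 2: "(\<Sum>j\<in>J. (cmod (c j) * cmod (pole_factor \<alpha> (\<i> * w - of_real (x + of_int j / \<beta>))))\<^sup>2) \<le> hi\<^sup>2 * (\<Sum>j\<in>J. (cmod (c j))\<^sup>2)"
      unfolding sum_distrib_left power_mult_distrib
      by (intro sum_mono) (use b(2) pos in \<open>auto simp: mult.commute[of "hi\<^sup>2"]
          simp del: of_real_add intro!: mult_left_mono power_mono\<close>)
    show "ennreal (\<beta> * lo\<^sup>2 * (\<Sum>j\<in>J. (cmod (c j))\<^sup>2)) \<le> (\<integral>\<^sup>+t. ennreal ((cmod (comb_part \<alpha> \<beta> J c x w t))\<^sup>2) \<partial>lborel_upto \<beta>)"
      unfolding nn_integral_comb_part[OF assms(2) J] mult.assoc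
      using 1 assms(2) by (intro ennreal_leI mult_left_mono) auto
    show "(\<integral>\<^sup>+t. ennreal ((cmod (comb_part \<alpha> \<beta> J c x w t))\<^sup>2) \<partial>lborel_upto \<beta>) \<le> ennreal (\<beta> * hi\<^sup>2 * (\<Sum>j\<in>J. (cmod (c j))\<^sup>2))"
      unfolding nn_integral_comb_part[OF assms(2) J] mult.assoc
      using 2 assms(2) by (intro ennreal_leI mult_left_mono) auto
  qed (use pos assms in auto)
qed

section \<open>Samples as Fourier coefficients, and the two sampling bounds\<close>

lemma has_sum_samples:
  fixes a w :: "'k \<Rightarrow> complex" and c :: "int \<Rightarrow> complex" and x :: real
  assumes \<alpha>: "\<alpha> > 0" and \<beta>: "\<beta> > 0" and K: "finite K" and w: "\<And>k. k \<in> K \<Longrightarrow> Re (w k) \<noteq> 0"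
    and J: "finite J"
    and g: "\<And>t. g t = (\<Sum>k\<in>K. a k / (complex_of_real t - \<i> * w k))"
  defines "\<Psi> \<equiv> \<lambda>t. \<Sum>k\<in>K. a k * exp (- 2 * of_real pi * w k * of_real t) * comb_part \<alpha> \<beta> J c x (w k) t"
  shows "((\<lambda>m. (cmod (\<Sum>j\<in>J. c j * g (x + of_int j / \<beta> - \<alpha> * of_int m)))\<^sup>2)
          has_sum (1 / \<alpha> * (\<integral>t. (cmod (\<Psi> t))\<^sup>2 \<partial>lborel_upto (1 / \<alpha>)))) (UNIV :: int set)"
proof -
  define s where "s k j = \<i> * w k - of_real (x + of_int j / \<beta>)" for k j
  \<comment> \<open>\<open>\<Phi>\<close> restores the unimodular factor that was stripped from
    \<open>\<Psi>\<close>. The samples are coefficients of \<open>\<Phi>\<close>, while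
    |\<open>\<Phi>\<close>| = |\<open>\<Psi>\<close>| keeps x out of the exponential
    weights.\<close>
  define \<Phi> where "\<Phi> t = cis (- 2 * pi * x * t) * \<Psi> t" for t
  define E where "E k j t = pole_factor \<alpha> (s k j) * exp (2 * of_real pi * \<i> * s k j * of_real t)" for k j t
  have \<Phi>: "\<Phi> t = (\<Sum>k\<in>K. \<Sum>j\<in>J. a k * c j * E k j t)" for t
  proof -
    have "exp (2 * of_real pi * \<i> * s k j * of_real t) = exp (- 2 * of_real pi * w k * of_real t) *
        (cnj (fourier_char \<beta> j t) * cis (- 2 * pi * x * t))" for k j
      unfolding cnj_fourier_char unfolding fourier_char_def cis_conv_exp exp_add[symmetric]
      using \<beta> by (simp add: s_def algebra_simps)
    thus ?thesis
      unfolding \<Phi>_def \<Psi>_def comb_part_def E_def sum_distrib_left s_def[symmetric]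
      by (simp add: mult_ac)
  qed
  have cont\<Psi>: "continuous_on UNIV \<Psi>" unfolding \<Psi>_def by (intro continuous_intros)
  have cont: "continuous_on UNIV \<Phi>" unfolding \<Phi>_def
    by (intro continuous_intros cont\<Psi>)
  \<comment> \<open>The coefficient of index n is the sample of index -n up to sign, because the
    conjugated character has index -n. The reflection is undone at the end by reindexing along
    negation.\<close>
  have coeff: "cmod (\<integral>t. \<Phi> t * cnj (fourier_char (1 / \<alpha>) n t) \<partial>lborel_upto (1 / \<alpha>)) =
               cmod (\<Sum>j\<in>J. c j * g (x + of_int j / \<beta> - \<alpha> * of_int (- n)))" for n
  proof -
    have int: "integrable (lborel_upto (1 / \<alpha>)) (\<lambda>t. E k j t * fourier_char (1 / \<alpha>) (- n) t)" for k j
      unfolding E_def by (intro integrable_lborel_upto_continuous continuous_intros)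
    have "(\<integral>t. \<Phi> t * cnj (fourier_char (1 / \<alpha>) n t) \<partial>lborel_upto (1 / \<alpha>)) =
      (\<integral>t. (\<Sum>k\<in>K. \<Sum>j\<in>J. a k * c j * (E k j t * fourier_char (1 / \<alpha>) (- n) t)) \<partial>lborel_upto (1 / \<alpha>))"
      by (simp add: \<Phi> cnj_fourier_char sum_distrib_right mult.assoc)
    also have "\<dots> = (\<Sum>k\<in>K. \<Sum>j\<in>J. a k * c j * (\<integral>t. E k j t * fourier_char (1 / \<alpha>) (- n) t \<partial>lborel_upto (1 / \<alpha>)))"
      using int by (simp add: Bochner_Integration.integral_sum)
    also have "\<dots> = (\<Sum>k\<in>K. \<Sum>j\<in>J. a k * c j * (1 / (s k j + of_real (\<alpha> * of_int (- n)))))"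
      by (intro sum.cong refl arg_cong2[where f = "(*)"])
         (unfold E_def, rule integral_pole[OF \<alpha>], use w in \<open>auto simp: s_def\<close>)
    also have "\<dots> = (\<Sum>j\<in>J. \<Sum>k\<in>K. a k * c j * (1 / (s k j + of_real (\<alpha> * of_int (- n)))))"
      by (rule sum.swap)
    also have "\<dots> = - (\<Sum>j\<in>J. c j * g (x + of_int j / \<beta> - \<alpha> * of_int (- n)))"
    proof -
      have "1 / (s k j + of_real (\<alpha> * of_int (- n))) =
            - (1 / (of_real (x + of_int j / \<beta> - \<alpha> * of_int (- n)) - \<i> * w k))" for k j
      proof -
        have "s k j + of_real (\<alpha> * of_int (- n)) =
              - (of_real (x + of_int j / \<beta> - \<alpha> * of_int (- n)) - \<i> * w k)" by (simp add: s_def)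
        thus ?thesis by (metis minus_divide_right)
      qed
      thus ?thesis
        by (simp only: g sum_distrib_left sum_negf[symmetric] mult_minus_right) (simp add: mult_ac)
    qed
    finally show ?thesis by simp
  qed
  have "((\<lambda>n. (cmod (\<integral>t. \<Phi> t * cnj (fourier_char (1 / \<alpha>) n t) \<partial>lborel_upto (1 / \<alpha>)))\<^sup>2)
            has_sum (1 / \<alpha> * (\<integral>t. (cmod (\<Phi> t))\<^sup>2 \<partial>lborel_upto (1 / \<alpha>)))) UNIV"
    by (rule parseval_continuous[OF _ cont]) (use \<alpha> in simp)
  moreover have "cmod (\<Phi> t) = cmod (\<Psi> t)" for t by (simp add: \<Phi>_def norm_mult)
  ultimately have "((\<lambda>n. (cmod (\<Sum>j\<in>J. c j * g (x + of_int j / \<beta> - \<alpha> * of_int (- n))))\<^sup>2)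
            has_sum (1 / \<alpha> * (\<integral>t. (cmod (\<Psi> t))\<^sup>2 \<partial>lborel_upto (1 / \<alpha>)))) UNIV"
    unfolding coeff by simp
  thus ?thesis
    using has_sum_reindex_bij_betw[OF bij_uminus, of
      "\<lambda>m. (cmod (\<Sum>j\<in>J. c j * g (x + of_int j / \<beta> - \<alpha> * of_int m)))\<^sup>2"] by simp
qed

lemma sample_upper_bound:
  fixes a w :: "'k \<Rightarrow> complex"
  assumes \<alpha>: "\<alpha> > 0" and \<beta>: "\<beta> > 0" and K: "finite K" and w: "\<And>k. k \<in> K \<Longrightarrow> Re (w k) \<noteq> 0"
    and g: "\<And>t. g t = (\<Sum>k\<in>K. a k / (complex_of_real t - \<i> * w k))"
  shows "\<exists>B>0. \<forall>J c x. finite J \<longrightarrow> (\<exists>s.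
      ((\<lambda>m. (cmod (\<Sum>j\<in>J. c j * g (x + of_int j / \<beta> - \<alpha> * of_int m)))\<^sup>2) has_sum s) (UNIV :: int set)
      \<and> s \<le> B * (\<Sum>j\<in>J. (cmod (c j))\<^sup>2))"
proof -
  \<comment> \<open>The least number of \<beta>-periods that cover [0, 1/\<alpha>].\<close>
  define n where "n = nat \<lceil>1 / (\<alpha> * \<beta>)\<rceil>"
  have n: "1 / \<alpha> \<le> real n * \<beta>"
  proof -
    have "1 / (\<alpha> * \<beta>) \<le> real n" unfolding n_def by linarith
    thus ?thesis using \<alpha> \<beta> by (simp add: field_simps)
  qed
  have "\<exists>P. 0 < P \<and> (\<forall>J c x. finite J \<longrightarrow>
     (\<integral>\<^sup>+t. ennreal ((cmod (comb_part \<alpha> \<beta> J c x (w k) t))\<^sup>2) \<partial>lborel_upto \<beta>) \<le> ennreal (P * (\<Sum>j\<in>J. (cmod (c j))\<^sup>2)))"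
    if "k \<in> K" for k
    using nn_integral_comb_part_bounds[OF \<alpha> \<beta> w[OF that]] by blast
  then obtain P where P: "\<And>k. k \<in> K \<Longrightarrow> 0 < P k" 
    "\<And>k J c x. k \<in> K \<Longrightarrow> finite J \<Longrightarrow> (\<integral>\<^sup>+t. ennreal ((cmod (comb_part \<alpha> \<beta> J c x (w k) t))\<^sup>2) \<partial>lborel_upto \<beta>)
        \<le> ennreal (P k * (\<Sum>j\<in>J. (cmod (c j))\<^sup>2))"
    by metis
  \<comment> \<open>The maximum over [0, 1/\<alpha>] of the exponential weight, bounded without
    distinguishing the sign of Re (w k).\<close>
  define b where "b k = cmod (a k) * exp (2 * pi * \<bar>Re (w k)\<bar> / \<alpha>)" for k
  define C where "C = (\<Sum>k\<in>K. (b k)\<^sup>2)"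
  have C: "C \<ge> 0" unfolding C_def by (intro sum_nonneg) auto
  have PK: "sum P K \<ge> 0" by (intro sum_nonneg) (use P(1) in \<open>auto intro: less_imp_le\<close>)
  \<comment> \<open>The added 1 makes \<open>B\<close> positive even if the main term vanishes, for
    instance for empty \<open>K\<close>.\<close>
  define B where "B = 1 / \<alpha> * (C * (real n * sum P K)) + 1"
  have B: "B > 0" unfolding B_def using \<alpha> C PK by (intro add_nonneg_pos mult_nonneg_nonneg) auto
  have "\<exists>s. ((\<lambda>m. (cmod (\<Sum>j\<in>J. c j * g (x + of_int j / \<beta> - \<alpha> * of_int m)))\<^sup>2) has_sum s) (UNIV :: int set)
      \<and> s \<le> B * (\<Sum>j\<in>J. (cmod (c j))\<^sup>2)" if J: "finite J" for J c x
  proof -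
    let ?D = "\<lambda>k. comb_part \<alpha> \<beta> J c x (w k)" and ?c = "\<Sum>j\<in>J. (cmod (c j))\<^sup>2"
    define \<Psi> where "\<Psi> t = (\<Sum>k\<in>K. a k * exp (- 2 * of_real pi * w k * of_real t) * ?D k t)" for t
    have cont: "continuous_on UNIV (\<lambda>t. (cmod (\<Psi> t))\<^sup>2)" unfolding \<Psi>_def by (intro continuous_intros)
    have [measurable]: "?D k \<in> borel_measurable borel" for k
      by (intro borel_measurable_continuous_onI continuous_intros)
    have c0: "?c \<ge> 0" by (intro sum_nonneg) auto
    have pt: "(cmod (\<Psi> t))\<^sup>2 \<le> C * (\<Sum>k\<in>K. (cmod (?D k t))\<^sup>2)" if t: "t \<in> {0..1 / \<alpha>}" for t
    proof -
      have "cmod (a k * exp (- 2 * of_real pi * w k * of_real t)) \<le> b k" for k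
      proof -
        have "2 * pi * (- Re (w k)) * t \<le> 2 * pi * \<bar>Re (w k)\<bar> * t"
          using t by (intro mult_right_mono mult_left_mono) auto
        also have "\<dots> \<le> 2 * pi * \<bar>Re (w k)\<bar> * (1 / \<alpha>)"
          using t by (intro mult_left_mono) auto
        finally show ?thesis by (simp add: b_def norm_mult norm_exp_eq_Re mult_left_mono)
      qed
      hence "cmod (\<Psi> t) \<le> (\<Sum>k\<in>K. b k * cmod (?D k t))" unfolding \<Psi>_def
        by (intro order_trans[OF norm_sum] sum_mono) (simp only: norm_mult[of "_ * _" "comb_part _ _ _ _ _ _ _"], intro mult_right_mono, auto)
      hence "(cmod (\<Psi> t))\<^sup>2 \<le> (\<Sum>k\<in>K. b k * cmod (?D k t))\<^sup>2" by (rule power_mono) auto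
      also have "\<dots> \<le> C * (\<Sum>k\<in>K. (cmod (?D k t))\<^sup>2)" unfolding C_def by (rule Cauchy_Schwarz_ineq_sum)
      finally show ?thesis .
    qed
    have "ennreal (\<integral>t. (cmod (\<Psi> t))\<^sup>2 \<partial>lborel_upto (1 / \<alpha>)) = (\<integral>\<^sup>+t. ennreal ((cmod (\<Psi> t))\<^sup>2) \<partial>lborel_upto (1 / \<alpha>))"
      by (rule ennreal_integral_continuous[symmetric, OF cont]) auto
    also have "\<dots> \<le> (\<integral>\<^sup>+t. ennreal C * (\<Sum>k\<in>K. ennreal ((cmod (?D k t))\<^sup>2)) \<partial>lborel_upto (1 / \<alpha>))"
      by (intro nn_integral_mono) (use pt C in \<open>auto simp: sum_ennreal sum_nonneg simp flip: ennreal_mult intro!: ennreal_leI\<close>)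
    \<comment> \<open>Enlarging the interval comes only after the exponential weights have been
      absorbed into \<open>C\<close>: the estimate \<open>pt\<close> holds on [0, 1/\<alpha>], but
      its right side is periodic and can be integrated over whole periods.\<close>
    also have "\<dots> \<le> (\<integral>\<^sup>+t. ennreal C * (\<Sum>k\<in>K. ennreal ((cmod (?D k t))\<^sup>2)) \<partial>lborel_upto (real n * \<beta>))"
      using n by (simp add: nn_integral_restrict_space) (intro nn_integral_mono, auto simp: indicator_def)
    also have "\<dots> = (\<integral>\<^sup>+t. (\<Sum>l<n. ennreal C * (\<Sum>k\<in>K. ennreal ((cmod (?D k (t + real l * \<beta>)))\<^sup>2))) \<partial>lborel_upto \<beta>)"
      by (rule nn_integral_lborel_upto_mult[OF \<beta>]) measurable
    also have "\<dots> = (\<integral>\<^sup>+t. of_nat n * (ennreal C * (\<Sum>k\<in>K. ennreal ((cmod (?D k t))\<^sup>2))) \<partial>lborel_upto \<beta>)"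
      using \<beta> by (simp add: comb_part_period)
    also have "\<dots> = of_nat n * (ennreal C * (\<Sum>k\<in>K. (\<integral>\<^sup>+t. ennreal ((cmod (?D k t))\<^sup>2) \<partial>lborel_upto \<beta>)))"
      by (subst nn_integral_cmult, measurable)+ (subst nn_integral_sum, auto)
    also have "\<dots> \<le> of_nat n * (ennreal C * (\<Sum>k\<in>K. ennreal (P k * ?c)))"
      by (intro mult_left_mono sum_mono P J) auto
    also have "\<dots> = ennreal (real n * (C * (sum P K * ?c)))"
    proof -
      have "(\<Sum>k\<in>K. ennreal (P k * ?c)) = ennreal (sum P K * ?c)"
        unfolding sum_distrib_right by (rule sum_ennreal) (use P(1) c0 in \<open>auto simp: less_imp_le\<close>)
      thus ?thesis
        using C PK c0 by (simp only: ennreal_of_nat_eq_real_of_nat ennreal_mult mult_nonneg_nonneg of_nat_0_le_iff)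
    qed
    finally have "(\<integral>t. (cmod (\<Psi> t))\<^sup>2 \<partial>lborel_upto (1 / \<alpha>)) \<le> real n * (C * (sum P K * ?c))"
      using C PK c0 by (subst (asm) ennreal_le_iff) auto
    hence "1 / \<alpha> * (\<integral>t. (cmod (\<Psi> t))\<^sup>2 \<partial>lborel_upto (1 / \<alpha>)) \<le> 1 / \<alpha> * (real n * (C * (sum P K * ?c)))"
      using \<alpha> by (intro mult_left_mono) auto
    also have "\<dots> \<le> B * ?c" using c0 by (simp add: B_def algebra_simps)
    finally show ?thesis
      using has_sum_samples[OF \<alpha> \<beta> K w J g, of c x] unfolding \<Psi>_def by blast
  qed
  thus ?thesis using B by blast
qed

text \<open>One summand suffices: every row sum carries all coefficients c j up to factors bounded
  away from 0, so recovering the row of \<open>k0\<close> controls the whole sequence. The inverse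
  of the Vandermonde system does not depend on t, J, c or x.\<close>

lemma sample_lower_bound:
  fixes a w :: "'k \<Rightarrow> complex"
  assumes \<alpha>: "\<alpha> > 0" and \<beta>: "\<beta> > 0" and K: "finite K" and w: "\<And>k. k \<in> K \<Longrightarrow> Re (w k) \<noteq> 0"
    and g: "\<And>t. g t = (\<Sum>k\<in>K. a k / (complex_of_real t - \<i> * w k))"
    and inj: "inj_on (\<lambda>k. Re (w k)) K" and k0: "k0 \<in> K" "a k0 \<noteq> 0"
    and density: "real (card K) * \<beta> \<le> 1 / \<alpha>"
  shows "\<exists>A>0. \<forall>J c x s. finite J \<longrightarrow>
      ((\<lambda>m. (cmod (\<Sum>j\<in>J. c j * g (x + of_int j / \<beta> - \<alpha> * of_int m)))\<^sup>2) has_sum s) (UNIV :: int set)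
      \<longrightarrow> A * (\<Sum>j\<in>J. (cmod (c j))\<^sup>2) \<le> s"
proof -
  define \<mu> where "\<mu> k = exp (- 2 * of_real pi * w k * of_real \<beta>)" for k
  have "inj_on \<mu> K"
  proof (rule inj_onI)
    fix k l assume kl: "k \<in> K" "l \<in> K" "\<mu> k = \<mu> l"
    hence "cmod (\<mu> k) = cmod (\<mu> l)" by simp
    \<comment> \<open>The modulus of the node is exp (-2 \<pi> \<beta> Re (w k)), so distinct real
      parts already give distinct moduli; imaginary parts cannot cause a coincidence.\<close>
    hence "Re (w k) = Re (w l)" using \<beta> by (simp add: \<mu>_def norm_exp_eq_Re)
    thus "k = l" using inj kl by (auto simp: inj_on_def)
  qed
  then obtain \<delta> where \<delta>: "\<delta> > 0"
    "\<And>b. \<delta> * (cmod (b k0))\<^sup>2 \<le> (\<Sum>l<card K. (cmod (\<Sum>k\<in>K. \<mu> k ^ l * b k))\<^sup>2)"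
    using vandermonde_lower_bound[OF K _ k0(1)] by blast
  obtain p where p: "p > 0" "\<And>J c x. finite J \<Longrightarrow> ennreal (p * (\<Sum>j\<in>J. (cmod (c j))\<^sup>2)) \<le>
      (\<integral>\<^sup>+t. ennreal ((cmod (comb_part \<alpha> \<beta> J c x (w k0) t))\<^sup>2) \<partial>lborel_upto \<beta>)"
    using nn_integral_comb_part_bounds[OF \<alpha> \<beta> w[OF k0(1)]] by blast
  \<comment> \<open>A lower bound for the weight of \<open>k0\<close> over [0, \<beta>]. One period
    is enough here, since the growth over further periods is carried by the powers of the
    nodes.\<close>
  define b where "b = cmod (a k0) * exp (- 2 * pi * \<bar>Re (w k0)\<bar> * \<beta>)"
  have b: "b > 0" using k0 by (simp add: b_def)
  define A where "A = 1 / \<alpha> * (\<delta> * b\<^sup>2 * p)"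
  have A: "A > 0" using \<alpha> \<delta>(1) b p(1) by (simp add: A_def)
  have "A * (\<Sum>j\<in>J. (cmod (c j))\<^sup>2) \<le> s" if J: "finite J" and
    s: "((\<lambda>m. (cmod (\<Sum>j\<in>J. c j * g (x + of_int j / \<beta> - \<alpha> * of_int m)))\<^sup>2) has_sum s) (UNIV :: int set)" for J c x s
  proof -
    let ?D = "\<lambda>k. comb_part \<alpha> \<beta> J c x (w k)" and ?c = "\<Sum>j\<in>J. (cmod (c j))\<^sup>2"
    define \<Psi> where "\<Psi> t = (\<Sum>k\<in>K. a k * exp (- 2 * of_real pi * w k * of_real t) * ?D k t)" for t
    have cont\<Psi>: "continuous_on UNIV \<Psi>" unfolding \<Psi>_def by (intro continuous_intros)
    have cont: "continuous_on UNIV (\<lambda>t. (cmod (\<Psi> t))\<^sup>2)" by (intro continuous_intros cont\<Psi>)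
    have [measurable]: "?D k \<in> borel_measurable borel" for k
      by (intro borel_measurable_continuous_onI continuous_intros)
    have [measurable]: "\<Psi> \<in> borel_measurable borel"
      by (rule borel_measurable_continuous_onI[OF cont\<Psi>])
    have c0: "?c \<ge> 0" by (intro sum_nonneg) auto
    have pt: "\<delta> * b\<^sup>2 * (cmod (?D k0 t))\<^sup>2 \<le> (\<Sum>l<card K. (cmod (\<Psi> (t + real l * \<beta>)))\<^sup>2)"
      if t: "t \<in> {0..\<beta>}" for t
    proof -
      \<comment> \<open>Shifting t by l \<beta> leaves the periodic row sum alone and multiplies the
        exponential by \<open>\<mu> k ^ l\<close>, so the \<open>e k\<close> are the unknowns of the
        Vandermonde system.\<close>
      define e where "e k = a k * exp (- 2 * of_real pi * w k * of_real t) * ?D k t" for k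
      have "\<Psi> (t + real l * \<beta>) = (\<Sum>k\<in>K. \<mu> k ^ l * e k)" for l
      proof -
        have "exp (- 2 * of_real pi * w k * of_real (t + real l * \<beta>)) =
              \<mu> k ^ l * exp (- 2 * of_real pi * w k * of_real t)" for k
          unfolding \<mu>_def exp_of_nat_mult[symmetric] exp_add[symmetric] by (simp add: algebra_simps)
        thus ?thesis
          unfolding \<Psi>_def e_def comb_part_period[OF less_imp_neq[OF \<beta>, symmetric]] by (simp add: mult_ac)
      qed
      hence le: "\<delta> * (cmod (e k0))\<^sup>2 \<le> (\<Sum>l<card K. (cmod (\<Psi> (t + real l * \<beta>)))\<^sup>2)"
        using \<delta>(2)[of e] by simp
      have "2 * pi * Re (w k0) * t \<le> 2 * pi * \<bar>Re (w k0)\<bar> * t"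
        using t by (intro mult_right_mono) auto
      also have "\<dots> \<le> 2 * pi * \<bar>Re (w k0)\<bar> * \<beta>"
        using t by (intro mult_left_mono) auto
      finally have "b \<le> cmod (a k0 * exp (- 2 * of_real pi * w k0 * of_real t))"
        by (simp add: b_def norm_mult norm_exp_eq_Re mult_left_mono)
      hence "b * cmod (?D k0 t) \<le> cmod (e k0)"
        unfolding e_def norm_mult[of "_ * _" "?D k0 t"] by (rule mult_right_mono) auto
      hence "(b * cmod (?D k0 t))\<^sup>2 \<le> (cmod (e k0))\<^sup>2" using b by (intro power_mono) auto
      hence "\<delta> * (b * cmod (?D k0 t))\<^sup>2 \<le> \<delta> * (cmod (e k0))\<^sup>2" using \<delta>(1) by (intro mult_left_mono) auto
      with le show ?thesis by (simp add: power_mult_distrib mult.assoc)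
    qed
    have "ennreal (\<delta> * b\<^sup>2 * (p * ?c)) = ennreal (\<delta> * b\<^sup>2) * ennreal (p * ?c)"
      using \<delta>(1) p(1) c0 by (intro ennreal_mult) auto
    also have "\<dots> \<le> ennreal (\<delta> * b\<^sup>2) * (\<integral>\<^sup>+t. ennreal ((cmod (?D k0 t))\<^sup>2) \<partial>lborel_upto \<beta>)"
      by (intro mult_left_mono p J) auto
    also have "\<dots> = (\<integral>\<^sup>+t. ennreal (\<delta> * b\<^sup>2) * ennreal ((cmod (?D k0 t))\<^sup>2) \<partial>lborel_upto \<beta>)"
      by (rule nn_integral_cmult[symmetric]) measurable
    also have "\<dots> \<le> (\<integral>\<^sup>+t. (\<Sum>l<card K. ennreal ((cmod (\<Psi> (t + real l * \<beta>)))\<^sup>2)) \<partial>lborel_upto \<beta>)"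
      using \<delta>(1) by (intro nn_integral_mono) (use pt in \<open>auto simp: sum_ennreal simp flip: ennreal_mult intro!: ennreal_leI\<close>)
    also have "\<dots> = (\<integral>\<^sup>+t. ennreal ((cmod (\<Psi> t))\<^sup>2) \<partial>lborel_upto (real (card K) * \<beta>))"
      by (rule nn_integral_lborel_upto_mult[OF \<beta>, symmetric]) measurable
    \<comment> \<open>The density condition enters here: [0, N \<beta>] lies inside [0, 1/\<alpha>],
      with equality of the intervals in the critical case.\<close>
    also have "\<dots> \<le> (\<integral>\<^sup>+t. ennreal ((cmod (\<Psi> t))\<^sup>2) \<partial>lborel_upto (1 / \<alpha>))"
      using density by (simp add: nn_integral_restrict_space) (intro nn_integral_mono, auto simp: indicator_def)
    also have "\<dots> = ennreal (\<integral>t. (cmod (\<Psi> t))\<^sup>2 \<partial>lborel_upto (1 / \<alpha>))"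
      by (rule ennreal_integral_continuous[OF cont]) auto
    finally have "\<delta> * b\<^sup>2 * (p * ?c) \<le> (\<integral>t. (cmod (\<Psi> t))\<^sup>2 \<partial>lborel_upto (1 / \<alpha>))"
      by (subst (asm) ennreal_le_iff) auto
    hence "1 / \<alpha> * (\<delta> * b\<^sup>2 * (p * ?c)) \<le> 1 / \<alpha> * (\<integral>t. (cmod (\<Psi> t))\<^sup>2 \<partial>lborel_upto (1 / \<alpha>))"
      using \<alpha> by (intro mult_left_mono) auto
    also have "\<dots> = s"
      using has_sum_samples[OF \<alpha> \<beta> K w J g, of c x] s unfolding \<Psi>_def by (rule has_sum_unique)
    finally show ?thesis by (simp add: A_def mult_ac)
  qed
  thus ?thesis using A by blast
qed

section \<open>Gabor coefficients of bounded, compactly supported functions\<close>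

text \<open>Sums become integrals against counting measure, so that Tonelli and Fatou apply without
  summability conditions.\<close>

lemma nn_integral_count_space_has_sum:
  fixes f :: "'a \<Rightarrow> real"
  assumes "(f has_sum s) UNIV" "\<And>x. f x \<ge> 0"
  shows "(\<integral>\<^sup>+x. ennreal (f x) \<partial>count_space UNIV) = ennreal s"
proof -
  have "f summable_on UNIV" using assms(1) by (rule has_sum_imp_summable)
  hence abs: "Infinite_Set_Sum.abs_summable_on f UNIV"
    using assms(2) by (simp flip: abs_summable_equivalent)
  hence "(\<integral>\<^sup>+x. ennreal (f x) \<partial>count_space UNIV) = ennreal (infsetsum f UNIV)"
    by (rule nn_integral_conv_infsetsum) (rule assms(2))
  also have "infsetsum f UNIV = s"
    using infsetsum_infsum[OF abs] infsumI[OF assms(1)] by simp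
  finally show ?thesis .
qed

text \<open>The way back to \<open>has_sum\<close>, in which the frame condition is phrased:
  finiteness of the integral supplies the summability.\<close>

lemma has_sum_of_nn_integral_count_space:
  fixes f :: "'a \<Rightarrow> real"
  assumes "(\<integral>\<^sup>+x. ennreal (f x) \<partial>count_space UNIV) = ennreal s" "\<And>x. f x \<ge> 0" "s \<ge> 0"
  shows "(f has_sum s) UNIV"
proof -
  have "Infinite_Set_Sum.abs_summable_on f UNIV" unfolding abs_summable_on_def
    using assms by (intro integrableI_bounded) auto
  hence "f summable_on UNIV" using assms(2) by (simp flip: abs_summable_equivalent)
  hence hs: "(f has_sum infsum f UNIV) UNIV" by simp
  moreover have "ennreal (infsum f UNIV) = ennreal s"
    using nn_integral_count_space_has_sum[OF hs assms(2)] assms(1) by simp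
  hence "infsum f UNIV = s"
    using assms by (subst (asm) ennreal_inj) (auto intro: infsum_nonneg)
  ultimately show ?thesis by simp
qed

text \<open>Compact support makes the periodization a finite sum, so for complex integrands
  linearity replaces Fubini.\<close>

lemma integral_periodize_finite:
  fixes F :: "real \<Rightarrow> complex"
  assumes L: "L > 0" and [measurable]: "F \<in> borel_measurable borel" and B: "\<And>t. cmod (F t) \<le> B"
    and supp: "\<And>t. \<bar>t\<bar> \<ge> real n * L \<Longrightarrow> F t = 0"
  shows "(\<integral>t. F t \<partial>lborel) = (\<integral>t. (\<Sum>j\<in>{- int n..<int n}. F (t + of_int j * L)) \<partial>lborel_upto L)"
proof -
  \<comment> \<open>The 2 n half-open tiles with these indices fill [-n L, n L) exactly; outside it
    \<open>F\<close> vanishes.\<close>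
  let ?J = "{- int n..<int n}" and ?I = "\<lambda>j::int. {real_of_int j * L..<(real_of_int j + 1) * L}"
  have int: "integrable lborel (\<lambda>t. indicator (?I j) t *\<^sub>R F t)" for j
  proof (rule integrableI_bounded_set[where A = "?I j" and B = B])
    show "emeasure lborel (?I j) < \<infinity>"
      using L by (cases "real_of_int j * L \<le> (real_of_int j + 1) * L") (auto simp: emeasure_lborel_Ico)
  qed (use B order_trans[OF norm_ge_zero B] in \<open>auto simp: indicator_def\<close>)
  have split: "F t = (\<Sum>j\<in>?J. indicator (?I j) t *\<^sub>R F t)" for t
  proof (cases "\<bar>t\<bar> \<ge> real n * L")
    case False
    have *: "t \<in> ?I j \<longleftrightarrow> j = \<lfloor>t / L\<rfloor>" for j :: int
      using L by (auto simp: floor_eq_iff field_simps eq_commute[of j])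
    have "- real n \<le> t / L" "t / L < real n" using False L by (auto simp: field_simps)
    hence "\<lfloor>t / L\<rfloor> \<in> ?J" by (simp add: le_floor_iff floor_less_iff)
    moreover have "(\<Sum>j\<in>?J. indicator (?I j) t *\<^sub>R F t) = (\<Sum>j\<in>?J. if \<lfloor>t / L\<rfloor> = j then F t else 0)"
      by (intro sum.cong refl) (use * in \<open>auto simp: indicator_def\<close>)
    ultimately show ?thesis by simp
  qed (simp add: supp)
  have "(\<integral>t. F t \<partial>lborel) = (\<integral>t. (\<Sum>j\<in>?J. indicator (?I j) t *\<^sub>R F t) \<partial>lborel)"
    by (rule Bochner_Integration.integral_cong[OF refl split])
  also have "\<dots> = (\<Sum>j\<in>?J. \<integral>t. indicator (?I j) t *\<^sub>R F t \<partial>lborel)"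
    by (rule Bochner_Integration.integral_sum) (rule int)
  also have "\<dots> = (\<Sum>j\<in>?J. \<integral>t. F (t + of_int j * L) \<partial>lborel_upto L)"
  proof (intro sum.cong refl)
    fix j
    have "(\<integral>t. indicator (?I j) t *\<^sub>R F t \<partial>lborel) =
          (\<integral>t. indicator (?I j) (of_int j * L + 1 * t) *\<^sub>R F (of_int j * L + 1 * t) \<partial>lborel)"
      by (subst lborel_integral_real_affine[of 1 _ "of_int j * L"]) auto
    also have "\<dots> = (\<integral>t. indicator {0..<L} t *\<^sub>R F (t + of_int j * L) \<partial>lborel)"
      by (intro Bochner_Integration.integral_cong) (auto simp: indicator_def algebra_simps)
    also have "\<dots> = (\<integral>t. indicator {0..L} t *\<^sub>R F (t + of_int j * L) \<partial>lborel)"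
    proof (rule integral_cong_AE)
      show "AE t in lborel. indicator {0..<L} t *\<^sub>R F (t + of_int j * L) = indicator {0..L} t *\<^sub>R F (t + of_int j * L)"
        using AE_lborel_singleton[of L] by eventually_elim (auto simp: indicator_def)
    qed measurable
    also have "\<dots> = (\<integral>t. F (t + of_int j * L) \<partial>lborel_upto L)"
      by (simp add: integral_restrict_space)
    finally show "(\<integral>t. indicator (?I j) t *\<^sub>R F t \<partial>lborel) = (\<integral>t. F (t + of_int j * L) \<partial>lborel_upto L)" .
  qed
  also have "\<dots> = (\<integral>t. (\<Sum>j\<in>?J. F (t + of_int j * L)) \<partial>lborel_upto L)"
    by (rule Bochner_Integration.integral_sum[symmetric])
       (rule integrable_lborel_upto[where B = B], measurable, rule B)
  finally show ?thesis .
qed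

text \<open>The modulations have period 1/\<beta>, so for fixed m the inner products are the Fourier
  coefficients of the periodization \<open>H m\<close>. Parseval removes the modulation index for
  each m separately, and Tonelli moves the sum over m inside the integral.\<close>

lemma nn_integral_gabor_coeffs:
  fixes f g :: "real \<Rightarrow> complex"
  assumes \<beta>: "\<beta> > 0" and [measurable]: "f \<in> borel_measurable borel" "g \<in> borel_measurable borel"
    and f: "\<And>t. cmod (f t) \<le> Bf" and g: "\<And>t. cmod (g t) \<le> Bg"
    and supp: "\<And>t. \<bar>t\<bar> \<ge> real n / \<beta> \<Longrightarrow> f t = 0"
  shows "(\<integral>\<^sup>+mn. ennreal (case mn of (m, n) \<Rightarrow> (cmod (L2_inner f (gabor_atom g \<alpha> \<beta> m n)))\<^sup>2) \<partial>count_space UNIV) =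
     ennreal (1 / \<beta>) * (\<integral>\<^sup>+t. (\<integral>\<^sup>+m. ennreal ((cmod (\<Sum>j\<in>{- int n..<int n}.
        cnj (f (t + of_int j / \<beta>)) * g (t + of_int j / \<beta> - \<alpha> * of_int m)))\<^sup>2) \<partial>count_space UNIV) \<partial>lborel_upto (1 / \<beta>))"
proof -
  let ?J = "{- int n..<int n}"
  define L where "L = 1 / \<beta>"
  have L: "L > 0" using \<beta> by (simp add: L_def)
  define H where "H m t = (\<Sum>j\<in>?J. f (t + of_int j * L) * cnj (g (t + of_int j * L - \<alpha> * of_int m)))" for m :: int and t
  have Hm [measurable]: "H m \<in> borel_measurable borel" for m unfolding H_def by measurable
  have Bg0: "Bg \<ge> 0" using order_trans[OF norm_ge_zero g] .
  have Bf0: "Bf \<ge> 0" using order_trans[OF norm_ge_zero f] .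
  have HB: "cmod (H m t) \<le> real (card ?J) * (Bf * Bg)" for m t
  proof -
    have "cmod (H m t) \<le> (\<Sum>j\<in>?J. Bf * Bg)" unfolding H_def
      by (intro order_trans[OF norm_sum] sum_mono) (auto simp: norm_mult intro!: mult_mono f g Bf0)
    thus ?thesis by simp
  qed
  have inner: "L2_inner f (gabor_atom g \<alpha> \<beta> m k) = (\<integral>t. H m t * cnj (fourier_char L k t) \<partial>lborel_upto L)" for m k
  proof -
    have atom: "gabor_atom g \<alpha> \<beta> m k t = fourier_char L k t * g (t - \<alpha> * of_int m)" for t
      by (simp add: gabor_atom_def fourier_char_eq_exp L_def mult_ac)
    have "L2_inner f (gabor_atom g \<alpha> \<beta> m k) =
        (\<integral>t. f t * cnj (fourier_char L k t * g (t - \<alpha> * of_int m)) \<partial>lborel)"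
      by (simp add: L2_inner_def atom)
    also have "\<dots> = (\<integral>t. (\<Sum>j\<in>?J. f (t + of_int j * L) * cnj (fourier_char L k (t + of_int j * L) *
                 g (t + of_int j * L - \<alpha> * of_int m))) \<partial>lborel_upto L)"
      by (rule integral_periodize_finite[OF L, where B = "Bf * Bg"])
         (use supp in \<open>auto simp: norm_mult L_def intro!: mult_mono f g Bf0\<close>)
    also have "\<dots> = (\<integral>t. H m t * cnj (fourier_char L k t) \<partial>lborel_upto L)"
      unfolding fourier_char_period[OF less_imp_neq[OF L, symmetric]] H_def sum_distrib_right
      by (simp add: mult_ac)
    finally show ?thesis .
  qed
  have pars: "(\<integral>\<^sup>+k. ennreal ((cmod (L2_inner f (gabor_atom g \<alpha> \<beta> m k)))\<^sup>2) \<partial>count_space UNIV) =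
              ennreal L * (\<integral>\<^sup>+t. ennreal ((cmod (H m t))\<^sup>2) \<partial>lborel_upto L)" for m
  proof -
    have "(\<integral>\<^sup>+k. ennreal ((cmod (L2_inner f (gabor_atom g \<alpha> \<beta> m k)))\<^sup>2) \<partial>count_space UNIV) =
          ennreal (L * (\<integral>t. (cmod (H m t))\<^sup>2 \<partial>lborel_upto L))"
      unfolding inner by (rule nn_integral_count_space_has_sum[OF parseval[OF L Hm HB]]) simp
    also have "\<dots> = ennreal L * ennreal (\<integral>t. (cmod (H m t))\<^sup>2 \<partial>lborel_upto L)"
      using L by (intro ennreal_mult) auto
    also have "ennreal (\<integral>t. (cmod (H m t))\<^sup>2 \<partial>lborel_upto L) = (\<integral>\<^sup>+t. ennreal ((cmod (H m t))\<^sup>2) \<partial>lborel_upto L)"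
    proof (rule nn_integral_eq_integral[symmetric])
      have "norm ((cmod (H m t))\<^sup>2) \<le> (real (card ?J) * (Bf * Bg))\<^sup>2" for t
        unfolding real_norm_def abs_power2 by (rule power_mono[OF HB]) simp
      thus "integrable (lborel_upto L) (\<lambda>t. (cmod (H m t))\<^sup>2)"
        by (intro integrable_lborel_upto) measurable
    qed simp
    finally show ?thesis .
  qed
  have "(\<integral>\<^sup>+mn. ennreal (case mn of (m, n) \<Rightarrow> (cmod (L2_inner f (gabor_atom g \<alpha> \<beta> m n)))\<^sup>2) \<partial>count_space UNIV) =
     (\<integral>\<^sup>+m. (\<integral>\<^sup>+k. ennreal ((cmod (L2_inner f (gabor_atom g \<alpha> \<beta> m k)))\<^sup>2) \<partial>count_space UNIV) \<partial>count_space UNIV)"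
    by (subst nn_integral_fst_count_space[symmetric]) simp
  also have "\<dots> = ennreal L * (\<integral>\<^sup>+m. (\<integral>\<^sup>+t. ennreal ((cmod (H m t))\<^sup>2) \<partial>lborel_upto L) \<partial>count_space UNIV)"
    unfolding pars by (rule nn_integral_cmult) simp
  also have "(\<integral>\<^sup>+m. (\<integral>\<^sup>+t. ennreal ((cmod (H m t))\<^sup>2) \<partial>lborel_upto L) \<partial>count_space UNIV) =
             (\<integral>\<^sup>+t. (\<integral>\<^sup>+m. ennreal ((cmod (H m t))\<^sup>2) \<partial>count_space UNIV) \<partial>lborel_upto L)"
    by (rule nn_integral_count_space_nn_integral[symmetric]) auto
  \<comment> \<open>Conjugating inside the modulus puts the samples of \<open>g\<close> in
    unconjugated form with coefficients cnj (f (t + j/\<beta>)), which is the shape of the sampling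
    bounds.\<close>
  also have "(\<lambda>m t. cmod (H m t)) = (\<lambda>m t. cmod (\<Sum>j\<in>?J. cnj (f (t + of_int j / \<beta>)) * g (t + of_int j / \<beta> - \<alpha> * of_int m)))"
  proof (intro ext)
    fix m t
    have "cmod (H m t) = cmod (cnj (H m t))" by simp
    also have "cnj (H m t) = (\<Sum>j\<in>?J. cnj (f (t + of_int j / \<beta>)) * g (t + of_int j / \<beta> - \<alpha> * of_int m))"
      by (simp add: H_def L_def)
    finally show "cmod (H m t) = cmod (\<Sum>j\<in>?J. cnj (f (t + of_int j / \<beta>)) * g (t + of_int j / \<beta> - \<alpha> * of_int m))" .
  qed
  finally show ?thesis by (simp only: L_def)
qed

lemma nn_integral_periodize_finite:
  fixes f :: "real \<Rightarrow> complex"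
  assumes \<beta>: "\<beta> > 0" and [measurable]: "f \<in> borel_measurable borel"
    and supp: "\<And>t. \<bar>t\<bar> \<ge> real n / \<beta> \<Longrightarrow> f t = 0"
  shows "(\<integral>\<^sup>+t. ennreal (\<Sum>j\<in>{- int n..<int n}. (cmod (f (t + of_int j / \<beta>)))\<^sup>2) \<partial>lborel_upto (1 / \<beta>)) =
         (\<integral>\<^sup>+t. ennreal ((cmod (f t))\<^sup>2) \<partial>lborel)"
proof -
  have "(\<integral>\<^sup>+t. ennreal ((cmod (f t))\<^sup>2) \<partial>lborel) =
    (\<integral>\<^sup>+t. (\<integral>\<^sup>+j. ennreal ((cmod (f (t + real_of_int j * (1 / \<beta>))))\<^sup>2) \<partial>count_space UNIV) \<partial>lborel_upto (1 / \<beta>))"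
    by (rule nn_integral_periodize) (use \<beta> in auto)
  also have "\<dots> = (\<integral>\<^sup>+t. ennreal (\<Sum>j\<in>{- int n..<int n}. (cmod (f (t + of_int j / \<beta>)))\<^sup>2) \<partial>lborel_upto (1 / \<beta>))"
  proof (rule nn_integral_cong)
    fix t assume "t \<in> space (lborel_upto (1 / \<beta>))"
    hence t: "0 \<le> t * \<beta>" "t * \<beta> \<le> 1" using \<beta> by (auto simp: field_simps)
    have "f (t + real_of_int j * (1 / \<beta>)) = 0" if "j \<notin> {- int n..<int n}" for j
    proof (rule supp)
      \<comment> \<open>The closed endpoint t \<beta> = 1 is still covered: for j = -n - 1 it gives
        absolute value exactly n, where \<open>f\<close> already vanishes.\<close>
      have "j + 1 \<le> - int n \<or> j \<ge> int n" using that by auto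
      hence "real_of_int j + 1 \<le> - real n \<or> real_of_int j \<ge> real n" by linarith
      hence "\<bar>t * \<beta> + real_of_int j\<bar> \<ge> real n" using t by linarith
      moreover have "\<bar>t + real_of_int j * (1 / \<beta>)\<bar> = \<bar>t * \<beta> + real_of_int j\<bar> / \<beta>"
        using \<beta> by (simp add: abs_divide[symmetric] field_simps flip: abs_mult_pos)
      ultimately show "real n / \<beta> \<le> \<bar>t + real_of_int j * (1 / \<beta>)\<bar>"
        using \<beta> by (simp add: divide_right_mono)
    qed
    hence "(\<integral>\<^sup>+j. ennreal ((cmod (f (t + real_of_int j * (1 / \<beta>))))\<^sup>2) \<partial>count_space UNIV) =
           (\<Sum>j\<in>{- int n..<int n}. ennreal ((cmod (f (t + real_of_int j * (1 / \<beta>))))\<^sup>2))"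
      by (intro nn_integral_count_space') auto
    thus "(\<integral>\<^sup>+j. ennreal ((cmod (f (t + real_of_int j * (1 / \<beta>))))\<^sup>2) \<partial>count_space UNIV) =
       ennreal (\<Sum>j\<in>{- int n..<int n}. (cmod (f (t + of_int j / \<beta>)))\<^sup>2)"
      by (simp add: sum_ennreal)
  qed
  finally show ?thesis by simp
qed

section \<open>Extension to all square-integrable functions\<close>

text \<open>Valued in the extended non-negative reals so that it makes sense before the coefficients
  are known to be square summable.\<close>

definition gabor_energy :: "(real \<Rightarrow> complex) \<Rightarrow> real \<Rightarrow> real \<Rightarrow> (real \<Rightarrow> complex) \<Rightarrow> ennreal" where
  "gabor_energy g \<alpha> \<beta> f =
     (\<integral>\<^sup>+mn. ennreal (case mn of (m, n) \<Rightarrow> (cmod (L2_inner f (gabor_atom g \<alpha> \<beta> m n)))\<^sup>2) \<partial>count_space UNIV)"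

lemma L2_measurable: "f \<in> L2 \<Longrightarrow> f \<in> borel_measurable borel"
  by (simp add: L2_def)

lemma L2_dominated:
  assumes "f \<in> L2" "h \<in> borel_measurable borel" "\<And>t. cmod (h t) \<le> cmod (f t)"
  shows "h \<in> L2"
proof -
  have "integrable lborel (\<lambda>t. (cmod (h t))\<^sup>2)"
    by (rule Bochner_Integration.integrable_bound[where f = "\<lambda>t. (cmod (f t))\<^sup>2"])
       (use assms in \<open>auto simp: L2_def intro!: AE_I2 power_mono\<close>)
  thus ?thesis using assms by (simp add: L2_def)
qed

lemma integrable_L2_mult:
  assumes "f \<in> L2" "h \<in> L2"
  shows "integrable lborel (\<lambda>t. f t * cnj (h t))"
proof (rule Bochner_Integration.integrable_bound[where f = "\<lambda>t. (cmod (f t))\<^sup>2 + (cmod (h t))\<^sup>2"])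
  show "integrable lborel (\<lambda>t. (cmod (f t))\<^sup>2 + (cmod (h t))\<^sup>2)"
    using assms by (auto simp: L2_def)
  show "(\<lambda>t. f t * cnj (h t)) \<in> borel_measurable lborel"
    using assms[THEN L2_measurable] by measurable
  show "AE t in lborel. norm (f t * cnj (h t)) \<le> norm ((cmod (f t))\<^sup>2 + (cmod (h t))\<^sup>2)"
  proof (rule AE_I2)
    fix t
    have "2 * (cmod (f t) * cmod (h t)) \<le> (cmod (f t))\<^sup>2 + (cmod (h t))\<^sup>2"
      using sum_squares_bound[of "cmod (f t)" "cmod (h t)"] by (simp add: mult.assoc)
    moreover have "0 \<le> cmod (f t) * cmod (h t)" by simp
    ultimately have "cmod (f t) * cmod (h t) \<le> (cmod (f t))\<^sup>2 + (cmod (h t))\<^sup>2" by linarith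
    thus "norm (f t * cnj (h t)) \<le> norm ((cmod (f t))\<^sup>2 + (cmod (h t))\<^sup>2)"
      by (simp add: norm_mult)
  qed
qed

lemma gabor_atom_in_L2:
  assumes "g \<in> L2"
  shows "gabor_atom g \<alpha> \<beta> m n \<in> L2"
proof -
  have [measurable]: "g \<in> borel_measurable borel" by (rule L2_measurable[OF assms])
  have "integrable lborel (\<lambda>t. (cmod (g (- (\<alpha> * of_int m) + 1 * t)))\<^sup>2)"
    using lborel_integrable_real_affine[of "\<lambda>t. (cmod (g t))\<^sup>2" 1 "- (\<alpha> * of_int m)"] assms
    by (simp add: L2_def)
  moreover have "cmod (gabor_atom g \<alpha> \<beta> m n t) = cmod (g (- (\<alpha> * of_int m) + 1 * t))" for t
    by (simp add: gabor_atom_def norm_mult norm_exp_eq_Re)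
  moreover have "gabor_atom g \<alpha> \<beta> m n \<in> borel_measurable borel"
    unfolding gabor_atom_def by measurable
  ultimately show ?thesis by (simp add: L2_def)
qed

text \<open>The termwise inequality |x - y|^2 \<le> 2 |x|^2 + 2 |y|^2 stands in for the triangle
  inequality of square-summable sequences and allows infinite energies. Its factor 2 is the origin
  of the halved lower frame bound.\<close>

lemma gabor_energy_diff:
  assumes "f \<in> L2" "h \<in> L2" "g \<in> L2"
  shows "gabor_energy g \<alpha> \<beta> (\<lambda>t. f t - h t) \<le> 2 * gabor_energy g \<alpha> \<beta> f + 2 * gabor_energy g \<alpha> \<beta> h"
proof -
  have "ennreal ((cmod (L2_inner (\<lambda>t. f t - h t) (gabor_atom g \<alpha> \<beta> m n)))\<^sup>2) \<le>
        2 * ennreal ((cmod (L2_inner f (gabor_atom g \<alpha> \<beta> m n)))\<^sup>2) +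
        2 * ennreal ((cmod (L2_inner h (gabor_atom g \<alpha> \<beta> m n)))\<^sup>2)" for m n
  proof -
    let ?x = "L2_inner f (gabor_atom g \<alpha> \<beta> m n)" and ?y = "L2_inner h (gabor_atom g \<alpha> \<beta> m n)"
    have "L2_inner (\<lambda>t. f t - h t) (gabor_atom g \<alpha> \<beta> m n) = ?x - ?y"
      using integrable_L2_mult[OF _ gabor_atom_in_L2[OF assms(3)]] assms
      by (simp add: L2_inner_def left_diff_distrib Bochner_Integration.integral_diff)
    moreover have "(cmod (?x - ?y))\<^sup>2 \<le> 2 * (cmod ?x)\<^sup>2 + 2 * (cmod ?y)\<^sup>2"
    proof -
      have "(cmod (?x - ?y))\<^sup>2 \<le> (cmod ?x + cmod ?y)\<^sup>2"
        by (intro power_mono norm_triangle_ineq4) auto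
      also have "\<dots> \<le> 2 * (cmod ?x)\<^sup>2 + 2 * (cmod ?y)\<^sup>2"
        using zero_le_power2[of "cmod ?x - cmod ?y"] by (simp add: power2_sum power2_diff)
      finally show ?thesis .
    qed
    ultimately show ?thesis
      by (simp add: ennreal_leI flip: ennreal_plus ennreal_mult ennreal_numeral)
  qed
  hence "gabor_energy g \<alpha> \<beta> (\<lambda>t. f t - h t) \<le>
     (\<integral>\<^sup>+mn. 2 * ennreal (case mn of (m, n) \<Rightarrow> (cmod (L2_inner f (gabor_atom g \<alpha> \<beta> m n)))\<^sup>2) +
             2 * ennreal (case mn of (m, n) \<Rightarrow> (cmod (L2_inner h (gabor_atom g \<alpha> \<beta> m n)))\<^sup>2) \<partial>count_space UNIV)"
    unfolding gabor_energy_def by (intro nn_integral_mono) auto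
  also have "\<dots> = 2 * gabor_energy g \<alpha> \<beta> f + 2 * gabor_energy g \<alpha> \<beta> h"
    unfolding gabor_energy_def by (simp add: nn_integral_add nn_integral_cmult)
  finally show ?thesis .
qed

lemma L2_dominated_convergence:
  assumes f: "f \<in> L2" and h: "h \<in> borel_measurable borel" "\<And>n. hn n \<in> borel_measurable borel"
    and le: "\<And>n t. cmod (hn n t) \<le> cmod (f t)" and lim: "\<And>t. (\<lambda>n. hn n t) \<longlonglongrightarrow> h t"
  shows "(\<lambda>n. L2_normsq (hn n)) \<longlonglongrightarrow> L2_normsq h"
    and "\<phi> \<in> L2 \<Longrightarrow> (\<lambda>n. L2_inner (hn n) \<phi>) \<longlonglongrightarrow> L2_inner h \<phi>"
proof -
  note [measurable] = h
  show "(\<lambda>n. L2_normsq (hn n)) \<longlonglongrightarrow> L2_normsq h"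
    unfolding L2_normsq_def
  proof (rule integral_dominated_convergence[where w = "\<lambda>t. (cmod (f t))\<^sup>2"])
    show "integrable lborel (\<lambda>t. (cmod (f t))\<^sup>2)" using f by (simp add: L2_def)
    show "AE t in lborel. (\<lambda>n. (cmod (hn n t))\<^sup>2) \<longlonglongrightarrow> (cmod (h t))\<^sup>2"
      by (intro AE_I2 tendsto_intros lim)
    show "AE t in lborel. norm ((cmod (hn n t))\<^sup>2) \<le> (cmod (f t))\<^sup>2" for n
      unfolding real_norm_def abs_power2 by (intro AE_I2 power_mono le) auto
  qed measurable
  show "(\<lambda>n. L2_inner (hn n) \<phi>) \<longlonglongrightarrow> L2_inner h \<phi>" if \<phi>: "\<phi> \<in> L2"
    unfolding L2_inner_def
  proof (rule integral_dominated_convergence[where w = "\<lambda>t. norm (f t * cnj (\<phi> t))"])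
    have [measurable]: "\<phi> \<in> borel_measurable borel" by (rule L2_measurable[OF \<phi>])
    show "integrable lborel (\<lambda>t. norm (f t * cnj (\<phi> t)))"
      by (intro integrable_norm integrable_L2_mult f \<phi>)
    show "AE t in lborel. (\<lambda>n. hn n t * cnj (\<phi> t)) \<longlonglongrightarrow> h t * cnj (\<phi> t)"
      by (intro AE_I2 tendsto_intros lim)
    show "AE t in lborel. norm (hn n t * cnj (\<phi> t)) \<le> norm (f t * cnj (\<phi> t))" for n
      by (intro AE_I2) (simp add: norm_mult mult_right_mono le)
    show "(\<lambda>t. h t * cnj (\<phi> t)) \<in> borel_measurable lborel" by measurable
    show "(\<lambda>t. hn n t * cnj (\<phi> t)) \<in> borel_measurable lborel" for n by measurable
  qed
qed

text \<open>Cutting the domain at a whole number of periods 1/\<beta> makes the periodization a sum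
  of 2 n terms, and cutting the values gives the boundedness that Parseval asks for. As each value
  is kept or dropped entirely, the truncation and its remainder are both dominated by |f|.\<close>

definition L2_trunc :: "real \<Rightarrow> nat \<Rightarrow> (real \<Rightarrow> complex) \<Rightarrow> real \<Rightarrow> complex" where
  "L2_trunc \<beta> n f t = (if \<bar>t\<bar> < real n / \<beta> \<and> cmod (f t) \<le> real n then f t else 0)"

lemma L2_trunc_measurable [measurable]:
  assumes [measurable]: "f \<in> borel_measurable borel"
  shows "L2_trunc \<beta> n f \<in> borel_measurable borel"
  unfolding L2_trunc_def[abs_def] by measurable

lemma norm_L2_trunc_le: "cmod (L2_trunc \<beta> n f t) \<le> cmod (f t)"
  and norm_diff_L2_trunc_le: "cmod (f t - L2_trunc \<beta> n f t) \<le> cmod (f t)"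
  by (simp_all add: L2_trunc_def)

lemma tendsto_L2_trunc:
  assumes "\<beta> > 0"
  shows "(\<lambda>n. L2_trunc \<beta> n f t) \<longlonglongrightarrow> f t"
proof -
  obtain N :: nat where N: "real N > max (\<bar>t\<bar> * \<beta>) (cmod (f t))" using reals_Archimedean2 by blast
  have "L2_trunc \<beta> n f t = f t" if "n \<ge> N" for n
  proof -
    have "real n > \<bar>t\<bar> * \<beta>" "real n > cmod (f t)" using N that by auto
    thus ?thesis using assms by (simp add: L2_trunc_def field_simps)
  qed
  hence "eventually (\<lambda>n. L2_trunc \<beta> n f t = f t) sequentially"
    unfolding eventually_sequentially by blast
  thus ?thesis by (rule tendsto_eventually)
qed

lemma L2_trunc_in_L2: "f \<in> L2 \<Longrightarrow> L2_trunc \<beta> n f \<in> L2"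
  using L2_dominated[of f "L2_trunc \<beta> n f"] norm_L2_trunc_le L2_measurable by (metis L2_trunc_measurable)

lemma diff_L2_trunc_in_L2: "f \<in> L2 \<Longrightarrow> (\<lambda>t. f t - L2_trunc \<beta> n f t) \<in> L2"
  by (rule L2_dominated[of f]) (use L2_measurable norm_diff_L2_trunc_le in auto)

lemma L2_normsq_nonneg: "L2_normsq f \<ge> 0"
  unfolding L2_normsq_def by (rule Bochner_Integration.integral_nonneg) auto

lemma L2_normsq_mono:
  assumes "f \<in> L2" "h \<in> L2" "\<And>t. cmod (h t) \<le> cmod (f t)"
  shows "L2_normsq h \<le> L2_normsq f"
  unfolding L2_normsq_def by (rule integral_mono) (use assms in \<open>auto simp: L2_def intro: power_mono\<close>)

text \<open>The upper bound passes to the limit by Fatou. For the lower bound each truncation is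
  written as f minus its remainder r: its energy is at most 2 energy(f) + 2 energy(r), and the upper
  bound, now valid on all of L2, makes the last term tend to 0.\<close>

lemma gabor_frame_if_truncated:
  assumes g: "g \<in> L2" and \<beta>: "\<beta> > 0" and A: "A > 0" and B: "B > 0"
    and bounds: "\<And>f n. f \<in> L2 \<Longrightarrow>
       ennreal (A * L2_normsq (L2_trunc \<beta> n f)) \<le> gabor_energy g \<alpha> \<beta> (L2_trunc \<beta> n f) \<and>
       gabor_energy g \<alpha> \<beta> (L2_trunc \<beta> n f) \<le> ennreal (B * L2_normsq (L2_trunc \<beta> n f))"
  shows "gabor_frame g \<alpha> \<beta>"
proof -
  have upper: "gabor_energy g \<alpha> \<beta> f \<le> ennreal (B * L2_normsq f)" if f: "f \<in> L2" for f
  proof -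
    let ?e = "\<lambda>f mn. ennreal (case mn of (m, n) \<Rightarrow> (cmod (L2_inner f (gabor_atom g \<alpha> \<beta> m n)))\<^sup>2)"
    have [measurable]: "f \<in> borel_measurable borel" by (rule L2_measurable[OF f])
    have "(\<lambda>k. ?e (L2_trunc \<beta> k f) mn) \<longlonglongrightarrow> ?e f mn" for mn
      unfolding split_beta
      by (intro tendsto_ennrealI tendsto_intros L2_dominated_convergence(2)[OF f] norm_L2_trunc_le
            tendsto_L2_trunc \<beta> gabor_atom_in_L2 g) auto
    hence "gabor_energy g \<alpha> \<beta> f = (\<integral>\<^sup>+mn. liminf (\<lambda>k. ?e (L2_trunc \<beta> k f) mn) \<partial>count_space UNIV)"
      unfolding gabor_energy_def by (intro nn_integral_cong lim_imp_Liminf[symmetric]) auto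
    also have "\<dots> \<le> liminf (\<lambda>k. gabor_energy g \<alpha> \<beta> (L2_trunc \<beta> k f))"
      unfolding gabor_energy_def by (rule nn_integral_liminf) auto
    also have "\<dots> \<le> liminf (\<lambda>k. ennreal (B * L2_normsq f))"
    proof (intro Liminf_mono always_eventually allI)
      fix k
      have "L2_normsq (L2_trunc \<beta> k f) \<le> L2_normsq f"
        by (intro L2_normsq_mono f L2_trunc_in_L2 norm_L2_trunc_le)
      hence "ennreal (B * L2_normsq (L2_trunc \<beta> k f)) \<le> ennreal (B * L2_normsq f)"
        using B by (intro ennreal_leI mult_left_mono) auto
      thus "gabor_energy g \<alpha> \<beta> (L2_trunc \<beta> k f) \<le> ennreal (B * L2_normsq f)"
        using bounds[OF f, of k] by (meson order_trans)
    qed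
    also have "\<dots> = ennreal (B * L2_normsq f)" by (simp add: Liminf_const)
    finally show ?thesis .
  qed
  \<comment> \<open>The minimum with \<open>B\<close> guarantees that the lower constant does not
    exceed the upper one, as the definition of a frame demands.\<close>
  have "\<exists>s. ((\<lambda>(m, n). (cmod (L2_inner f (gabor_atom g \<alpha> \<beta> m n)))\<^sup>2) has_sum s) UNIV
          \<and> min (A / 2) B * L2_normsq f \<le> s \<and> s \<le> B * L2_normsq f" if f: "f \<in> L2" for f
  proof -
    have [measurable]: "f \<in> borel_measurable borel" by (rule L2_measurable[OF f])
    let ?r = "\<lambda>k t. f t - L2_trunc \<beta> k f t"
    define s where "s = enn2real (gabor_energy g \<alpha> \<beta> f)"
    have "gabor_energy g \<alpha> \<beta> f < top" using upper[OF f] by (simp add: le_less_trans)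
    hence s: "gabor_energy g \<alpha> \<beta> f = ennreal s" "s \<ge> 0" by (simp_all add: s_def)
    have "((\<lambda>(m, n). (cmod (L2_inner f (gabor_atom g \<alpha> \<beta> m n)))\<^sup>2) has_sum s) UNIV"
      by (rule has_sum_of_nn_integral_count_space) (use s in \<open>auto simp: gabor_energy_def\<close>)
    moreover have "s \<le> B * L2_normsq f"
      using upper[OF f] B L2_normsq_nonneg[of f] unfolding s(1) by (subst (asm) ennreal_le_iff) auto
    moreover have "A * L2_normsq f \<le> 2 * s"
    proof (rule LIMSEQ_le)
      show "(\<lambda>k. A * L2_normsq (L2_trunc \<beta> k f)) \<longlonglongrightarrow> A * L2_normsq f"
        by (intro tendsto_intros L2_dominated_convergence(1)[OF f] norm_L2_trunc_le
            tendsto_L2_trunc \<beta>) auto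
      have "(\<lambda>k. L2_normsq (?r k)) \<longlonglongrightarrow> L2_normsq (\<lambda>t. f t - f t)"
        by (intro L2_dominated_convergence(1)[OF f] norm_diff_L2_trunc_le tendsto_diff tendsto_const
            tendsto_L2_trunc \<beta>) auto
      hence "(\<lambda>k. 2 * s + 2 * (B * L2_normsq (?r k))) \<longlonglongrightarrow> 2 * s + 2 * (B * L2_normsq (\<lambda>t. f t - f t))"
        by (intro tendsto_intros)
      thus "(\<lambda>k. 2 * s + 2 * (B * L2_normsq (?r k))) \<longlonglongrightarrow> 2 * s"
        by (simp add: L2_normsq_def)
      have "A * L2_normsq (L2_trunc \<beta> k f) \<le> 2 * s + 2 * (B * L2_normsq (?r k))" for k
      proof -
        have "ennreal (A * L2_normsq (L2_trunc \<beta> k f)) \<le> gabor_energy g \<alpha> \<beta> (\<lambda>t. f t - ?r k t)"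
          using bounds[OF f, of k] by simp
        also have "\<dots> \<le> 2 * gabor_energy g \<alpha> \<beta> f + 2 * gabor_energy g \<alpha> \<beta> (?r k)"
          by (intro gabor_energy_diff f diff_L2_trunc_in_L2 g)
        also have "\<dots> \<le> 2 * ennreal s + 2 * ennreal (B * L2_normsq (?r k))"
          unfolding s(1) by (intro add_left_mono mult_left_mono upper diff_L2_trunc_in_L2 f) auto
        also have "\<dots> = ennreal (2 * s + 2 * (B * L2_normsq (?r k)))"
          using s(2) B L2_normsq_nonneg[of "?r k"] by (simp add: ennreal_mult)
        finally show ?thesis
          using s(2) B L2_normsq_nonneg[of "?r k"] by (subst (asm) ennreal_le_iff) auto
      qed
      thus "\<exists>N. \<forall>k\<ge>N. A * L2_normsq (L2_trunc \<beta> k f) \<le> 2 * s + 2 * (B * L2_normsq (?r k))" by blast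
    qed
    moreover have "min (A / 2) B * L2_normsq f \<le> A / 2 * L2_normsq f"
      by (intro mult_right_mono L2_normsq_nonneg) auto
    ultimately show ?thesis by (intro exI[of _ s]) auto
  qed
  thus ?thesis unfolding gabor_frame_def
    using A B by (intro exI[of _ "min (A / 2) B"] exI[of _ B]) auto
qed

text \<open>Square integrability is read off the sampling bound for a single coefficient on the integers.\<close>

lemma sum_simple_fractions_in_L2:
  fixes a w :: "'k \<Rightarrow> complex"
  assumes K: "finite K" and w: "\<And>k. k \<in> K \<Longrightarrow> Re (w k) \<noteq> 0"
    and g: "\<And>t. g t = (\<Sum>k\<in>K. a k / (complex_of_real t - \<i> * w k))"
  shows "g \<in> L2" "\<exists>C. \<forall>t. cmod (g t) \<le> C"
proof -
  have nz: "complex_of_real t - \<i> * w k \<noteq> 0" if "k \<in> K" for t k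
    using w[OF that] by (auto simp: complex_eq_iff)
  have "continuous_on UNIV (\<lambda>t. \<Sum>k\<in>K. a k / (complex_of_real t - \<i> * w k))"
    by (intro continuous_intros) (use nz in auto)
  hence [measurable]: "g \<in> borel_measurable borel"
    unfolding g[symmetric] by (rule borel_measurable_continuous_onI)
  obtain B where B: "B > 0" and sampled: "\<And>J c x. finite J \<Longrightarrow> \<exists>s.
      ((\<lambda>m. (cmod (\<Sum>j\<in>J. c j * g (x + of_int j / 1 - 1 * of_int m)))\<^sup>2) has_sum s) (UNIV :: int set)
      \<and> s \<le> B * (\<Sum>j\<in>J. (cmod (c j))\<^sup>2)"
    using sample_upper_bound[OF zero_less_one zero_less_one K w g] by blast
  have sum_le: "(\<integral>\<^sup>+m. ennreal ((cmod (g (x + real_of_int m * 1)))\<^sup>2) \<partial>count_space UNIV) \<le> ennreal B" for x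
  proof -
    obtain s where s: "((\<lambda>m. (cmod (g (x - of_int m)))\<^sup>2) has_sum s) (UNIV :: int set)" "s \<le> B"
      using sampled[of "{0}" "\<lambda>_. 1" x] by auto
    have "(\<integral>\<^sup>+m. ennreal ((cmod (g (x + real_of_int m * 1)))\<^sup>2) \<partial>count_space UNIV) =
          (\<integral>\<^sup>+m. ennreal ((cmod (g (x + real_of_int (- m) * 1)))\<^sup>2) \<partial>count_space UNIV)"
      by (rule nn_integral_bij_count_space[symmetric, OF bij_uminus])
    also have "\<dots> = ennreal s" using nn_integral_count_space_has_sum[OF s(1)] by simp
    finally show ?thesis using s(2) by (simp add: ennreal_leI)
  qed
  have "(\<integral>\<^sup>+t. ennreal ((cmod (g t))\<^sup>2) \<partial>lborel) =
        (\<integral>\<^sup>+t. (\<integral>\<^sup>+m. ennreal ((cmod (g (t + real_of_int m * 1)))\<^sup>2) \<partial>count_space UNIV) \<partial>lborel_upto 1)"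
    by (rule nn_integral_periodize) auto
  also have "\<dots> \<le> (\<integral>\<^sup>+t. ennreal B \<partial>lborel_upto 1)"
    by (intro nn_integral_mono sum_le)
  also have "\<dots> < top" by (simp add: emeasure_restrict_space ennreal_mult_less_top)
  finally have "integrable lborel (\<lambda>t. (cmod (g t))\<^sup>2)"
    by (intro integrableI_bounded) auto
  thus "g \<in> L2" by (simp add: L2_def)
  have "cmod (g t) \<le> (\<Sum>k\<in>K. cmod (a k) / \<bar>Re (w k)\<bar>)" for t
    unfolding g
  proof (intro order_trans[OF norm_sum] sum_mono)
    fix k assume k: "k \<in> K"
    have "\<bar>Re (w k)\<bar> \<le> cmod (complex_of_real t - \<i> * w k)"
      using abs_Im_le_cmod[of "complex_of_real t - \<i> * w k"] by simp
    thus "cmod (a k / (complex_of_real t - \<i> * w k)) \<le> cmod (a k) / \<bar>Re (w k)\<bar>"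
      unfolding norm_divide using w[OF k] nz[OF k] by (intro divide_left_mono mult_pos_pos) auto
  qed
  thus "\<exists>C. \<forall>t. cmod (g t) \<le> C" by blast
qed

text \<open>For each t the sampling bounds are used with x = t and c j = cnj (f (t + j/\<beta>)).
  Integrating over one period 1/\<beta> turns the sum of |c j|^2 into the squared norm of f; the
  factor 1/\<beta> in the constants is the Parseval normalisation.\<close>

lemma gabor_frame_simple_fractions:
  fixes a w :: "'k \<Rightarrow> complex"
  assumes \<alpha>: "\<alpha> > 0" and \<beta>: "\<beta> > 0" and K: "finite K" and w: "\<And>k. k \<in> K \<Longrightarrow> Re (w k) \<noteq> 0"
    and g: "\<And>t. g t = (\<Sum>k\<in>K. a k / (complex_of_real t - \<i> * w k))"
    and inj: "inj_on (\<lambda>k. Re (w k)) K" and k0: "k0 \<in> K" "a k0 \<noteq> 0"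
    and density: "real (card K) * \<beta> \<le> 1 / \<alpha>"
  shows "gabor_frame g \<alpha> \<beta>"
proof -
  obtain B where B: "B > 0" and upper: "\<And>J c x. finite J \<Longrightarrow> \<exists>s.
    ((\<lambda>m. (cmod (\<Sum>j\<in>J. c j * g (x + of_int j / \<beta> - \<alpha> * of_int m)))\<^sup>2) has_sum s) (UNIV :: int set)
    \<and> s \<le> B * (\<Sum>j\<in>J. (cmod (c j))\<^sup>2)"
    using sample_upper_bound[OF \<alpha> \<beta> K w g] by blast
  obtain A where A: "A > 0" and lower: "\<And>J c x s. finite J \<Longrightarrow>
    ((\<lambda>m. (cmod (\<Sum>j\<in>J. c j * g (x + of_int j / \<beta> - \<alpha> * of_int m)))\<^sup>2) has_sum s) (UNIV :: int set)
    \<Longrightarrow> A * (\<Sum>j\<in>J. (cmod (c j))\<^sup>2) \<le> s"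
    using sample_lower_bound[OF \<alpha> \<beta> K w g inj k0 density] by blast
  have gL2: "g \<in> L2" using sum_simple_fractions_in_L2(1)[OF K w g] .
  obtain C where C: "\<And>t. cmod (g t) \<le> C"
    using sum_simple_fractions_in_L2(2)[OF K w g] by blast
  show ?thesis
  proof (rule gabor_frame_if_truncated[OF gL2 \<beta>])
    fix f n assume f: "f \<in> L2"
    let ?f = "L2_trunc \<beta> n f"
    let ?J = "{- int n..<int n}"
    have fm [measurable]: "?f \<in> borel_measurable borel" by (intro L2_trunc_measurable L2_measurable f)
    have supp: "?f t = 0" if "\<bar>t\<bar> \<ge> real n / \<beta>" for t using that by (simp add: L2_trunc_def)
    define S where "S t = (\<integral>\<^sup>+m. ennreal ((cmod (\<Sum>j\<in>?J. cnj (?f (t + of_int j / \<beta>)) *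
        g (t + of_int j / \<beta> - \<alpha> * of_int m)))\<^sup>2) \<partial>count_space UNIV)" for t
    define q where "q t = (\<Sum>j\<in>?J. (cmod (?f (t + of_int j / \<beta>)))\<^sup>2)" for t
    have q0: "q t \<ge> 0" for t unfolding q_def by (intro sum_nonneg) auto
    have [measurable]: "q \<in> borel_measurable borel" unfolding q_def by measurable
    have energy: "gabor_energy g \<alpha> \<beta> ?f = ennreal (1 / \<beta>) * (\<integral>\<^sup>+t. S t \<partial>lborel_upto (1 / \<beta>))"
      unfolding gabor_energy_def S_def
    proof (rule nn_integral_gabor_coeffs[OF \<beta> fm L2_measurable[OF gL2] _ C supp])
      show "cmod (?f t) \<le> real n" for t by (simp add: L2_trunc_def)
    qed
    have S: "ennreal (A * q t) \<le> S t" "S t \<le> ennreal (B * q t)" for t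
    proof -
      obtain s where s: "((\<lambda>m. (cmod (\<Sum>j\<in>?J. cnj (?f (t + of_int j / \<beta>)) *
          g (t + of_int j / \<beta> - \<alpha> * of_int m)))\<^sup>2) has_sum s) (UNIV :: int set)" "s \<le> B * q t"
        using upper[of ?J "\<lambda>j. cnj (?f (t + of_int j / \<beta>))" t] by (auto simp: q_def)
      have "A * q t \<le> s" using lower[OF _ s(1)] by (simp add: q_def)
      moreover have "S t = ennreal s" unfolding S_def by (rule nn_integral_count_space_has_sum[OF s(1)]) simp
      ultimately show "ennreal (A * q t) \<le> S t" "S t \<le> ennreal (B * q t)" using s(2) by (simp_all add: ennreal_leI)
    qed
    have norm: "(\<integral>\<^sup>+t. ennreal (r * q t) \<partial>lborel_upto (1 / \<beta>)) = ennreal (r * L2_normsq ?f)" if "r > 0" for r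
    proof -
      have "(\<integral>\<^sup>+t. ennreal (r * q t) \<partial>lborel_upto (1 / \<beta>)) = (\<integral>\<^sup>+t. ennreal r * ennreal (q t) \<partial>lborel_upto (1 / \<beta>))"
        using that q0 by (simp add: ennreal_mult)
      also have "\<dots> = ennreal r * (\<integral>\<^sup>+t. ennreal (q t) \<partial>lborel_upto (1 / \<beta>))"
        by (rule nn_integral_cmult) measurable
      also have "(\<integral>\<^sup>+t. ennreal (q t) \<partial>lborel_upto (1 / \<beta>)) = (\<integral>\<^sup>+t. ennreal ((cmod (?f t))\<^sup>2) \<partial>lborel)"
        unfolding q_def by (rule nn_integral_periodize_finite[OF \<beta> fm supp])
      also have "\<dots> = ennreal (L2_normsq ?f)" unfolding L2_normsq_def
        by (rule nn_integral_eq_integral) (use L2_trunc_in_L2[OF f, of \<beta> n] in \<open>auto simp: L2_def\<close>)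
      finally show ?thesis using that L2_normsq_nonneg by (simp add: ennreal_mult)
    qed
    have scale: "ennreal (1 / \<beta> * r * L2_normsq ?f) = ennreal (1 / \<beta>) * ennreal (r * L2_normsq ?f)"
      if "r > 0" for r
      unfolding mult.assoc using that \<beta> L2_normsq_nonneg by (intro ennreal_mult) auto
    have "ennreal (1 / \<beta> * A * L2_normsq ?f) \<le> gabor_energy g \<alpha> \<beta> ?f"
      unfolding energy scale[OF A] norm[OF A, symmetric] by (intro mult_left_mono nn_integral_mono S) auto
    moreover have "gabor_energy g \<alpha> \<beta> ?f \<le> ennreal (1 / \<beta> * B * L2_normsq ?f)"
      unfolding energy scale[OF B] norm[OF B, symmetric] by (intro mult_left_mono nn_integral_mono S) auto
    ultimately show "ennreal (1 / \<beta> * A * L2_normsq ?f) \<le> gabor_energy g \<alpha> \<beta> ?f \<and>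
        gabor_energy g \<alpha> \<beta> ?f \<le> ennreal (1 / \<beta> * B * L2_normsq ?f)" ..
  qed (use A B \<beta> in auto)
qed

theorem theorem1p7:
  fixes N :: nat and a w :: "nat \<Rightarrow> complex" and g :: "real \<Rightarrow> complex"
  assumes g_def: "\<And>t. g t = (\<Sum>k=1..N. a k / (complex_of_real t - \<i> * w k))"
    and a_nz: "\<And>k. k \<in> {1..N} \<Longrightarrow> a k \<noteq> 0"
    and w_re: "\<And>k. k \<in> {1..N} \<Longrightarrow> Re (w k) \<noteq> 0"
    and w_dist: "\<And>k l. k \<in> {1..N} \<Longrightarrow> l \<in> {1..N} \<Longrightarrow> k \<noteq> l \<Longrightarrow> Re (w k) \<noteq> Re (w l)"
  shows "{(\<alpha>, \<beta>). \<alpha> > 0 \<and> \<beta> > 0 \<and> \<alpha> * \<beta> \<le> 1 / real N} \<subseteq> frame_set g"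
proof -
  have "gabor_frame g \<alpha> \<beta>" if \<alpha>: "\<alpha> > 0" and \<beta>: "\<beta> > 0" and le: "\<alpha> * \<beta> \<le> 1 / real N" for \<alpha> \<beta>
  proof -
    \<comment> \<open>Since 1 / 0 = 0 for reals, the case N = 0 would require \<alpha> \<beta> \<le>
      0, so the set of parameters is empty there. A positive N provides the index 1 as
      \<open>k0\<close>.\<close>
    have N: "N > 0"
    proof (rule ccontr)
      assume "\<not> N > 0"
      hence "\<alpha> * \<beta> \<le> 0" using le by simp
      thus False using mult_pos_pos[OF \<alpha> \<beta>] by linarith
    qed
    have density: "real (card {1..N}) * \<beta> \<le> 1 / \<alpha>"
      using le \<alpha> N by (simp add: field_simps)
    have inj: "inj_on (\<lambda>k. Re (w k)) {1..N}" using w_dist by (meson inj_onI)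
    have one: "1 \<in> {1..N}" using N by simp
    show ?thesis
      by (rule gabor_frame_simple_fractions[OF \<alpha> \<beta> finite_atLeastAtMost w_re g_def inj one a_nz[OF one] density])
  qed
  thus ?thesis by (auto simp: frame_set_def)
qed

end
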